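(* Let $K$ be a field, let $P_n=\{p_1,\dots,p_n\}$ ($n\ge1$) be a finite poset with $n$ elements such that $p_i\le p_j$ implies $i\le j$, and let $G=G(P_n)$. Then the $h$-vector of the vertex cover algebra $A(G)$ is unimodal.
   Context: $G(P_n)$ is the bipartite graph on $\{x_1,\dots,x_n\}\cup\{y_1,\dots,y_n\}$ whose edges are all $\{x_i,y_j\}$ with $p_i\le p_j$. Let $S=K[x_1,\dots,x_n,y_1,\dots,y_n]$. A $k$-vertex cover of $G$ ($k\in\mathbb N$, $0\in\mathbb N$) is a vector $c\in\mathbb N^{2n}$, indexed by the vertices, with $c(v)+c(w)\ge k$ for every edge $\{v,w\}$. The vertex cover algebra $A(G)$ is the subalgebra of $S[t]$ generated over $K$ by all monomials $x_1^{c_1}\cdots x_n^{c_n}y_1^{c_{n+1}}\cdots y_n^{c_{2n}}t^k$ with $c$ a $k$-vertex cover, $k\in\mathbb N$. It is known that $A(G)=\bigoplus_{k\ge0}I_G^kt^k$, where the cover ideal $I_G\subset S$ is minimally generated by the monomials $m_C=\prod_{v\in C}v$, $C$ a minimal vertex cover of $G$, and each such $C$ has exactly $n$ elements. $A(G)$ is a standard graded $K$-algebra by giving degree $1$ to each $x_i$, each $y_j$ and each $m_Ct$. Its Krull dimension is $2n+1$, and its $h$-vector is the coefficient sequence $(h_0,h_1,\dots)$ of the polynomial $h(z)$ with $H_{A(G)}(z)=h(z)/(1-z)^{2n+1}$. A finite sequence is unimodal if it is weakly increasing up to some index and weakly decreasing from that index on. *)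

theory Defs
  imports
    "HOL-Library.Poly_Mapping"
    "HOL-Computational_Algebra.Computational_Algebra"
begin

section \<open>Graphs, vertex covers and the bipartite graph of a poset\<close>

type_synonym 'v graph = "'v set \<times> 'v set set"

definition is_k_cover :: "'v graph \<Rightarrow> nat \<Rightarrow> ('v \<Rightarrow>\<^sub>0 nat) \<Rightarrow> bool" where
  "is_k_cover G k c \<longleftrightarrow>
     Poly_Mapping.keys c \<subseteq> fst G \<and>
     (\<forall>v w. {v, w} \<in> snd G \<longrightarrow> Poly_Mapping.lookup c v + Poly_Mapping.lookup c w \<ge> k)"

definition is_vertex_cover :: "'v graph \<Rightarrow> 'v set \<Rightarrow> bool" where
  "is_vertex_cover G C \<longleftrightarrow> C \<subseteq> fst G \<and> (\<forall>e\<in>snd G. e \<inter> C \<noteq> {})"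

definition is_minimal_vertex_cover :: "'v graph \<Rightarrow> 'v set \<Rightarrow> bool" where
  "is_minimal_vertex_cover G C \<longleftrightarrow>
     is_vertex_cover G C \<and> (\<forall>D. D \<subset> C \<longrightarrow> \<not> is_vertex_cover G D)"

datatype vertex = X nat | Y nat

text \<open>The poset has carrier \<open>{p 1, \<dots>, p n}\<close> and order relation \<open>r\<close>.\<close>

definition poset_graph :: "nat \<Rightarrow> (nat \<Rightarrow> 'a) \<Rightarrow> 'a rel \<Rightarrow> vertex graph" where
  "poset_graph n p r =
     (X ` {1..n} \<union> Y ` {1..n},
      {{X i, Y j} | i j. i \<in> {1..n} \<and> j \<in> {1..n} \<and> (p i, p j) \<in> r})"

section \<open>The vertex cover algebra\<close>

text \<open>
  A multivariate polynomial is a finitely supported function from exponent vectors to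
  coefficients; \<open>S\<close> is realised inside the polynomial ring whose variables are all elements of
  the vertex type, and \<open>S[t]\<close> is the univariate polynomial ring over it.  Exponents of
  \<open>k\<close>-covers are supported on the vertices of the graph, so only the variables
  of \<open>S\<close> occur in the vertex cover algebra.
\<close>

type_synonym ('v, 'k) S = "('v \<Rightarrow>\<^sub>0 nat) \<Rightarrow>\<^sub>0 'k"

definition monomial :: "('v \<Rightarrow>\<^sub>0 nat) \<Rightarrow> ('v, 'k::field) S" where
  "monomial c = Poly_Mapping.single c 1"

definition variable :: "'v \<Rightarrow> ('v, 'k::field) S" where
  "variable v = monomial (Poly_Mapping.single v 1)"

definition cover_monomial :: "'v set \<Rightarrow> ('v, 'k::field) S" where
  "cover_monomial C = (\<Prod>v\<in>C. variable v)"

definition scalar :: "'k::field \<Rightarrow> ('v, 'k) S poly" where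
  "scalar a = [:Poly_Mapping.single 0 a:]"

definition is_subalgebra :: "('v, 'k::field) S poly set \<Rightarrow> bool" where
  "is_subalgebra B \<longleftrightarrow>
     range scalar \<subseteq> B \<and> (\<forall>f\<in>B. \<forall>g\<in>B. f + g \<in> B \<and> f * g \<in> B)"

definition vertex_cover_algebra :: "'v graph \<Rightarrow> ('v, 'k::field) S poly set" where
  "vertex_cover_algebra G = is_subalgebra hull {monom (monomial c) k | c k. is_k_cover G k c}"

section \<open>Gradings, Hilbert series and the \<open>h\<close>-vector\<close>

interpretation K_space: vector_space "\<lambda>(a::'k::field) (f::('v, 'k) S poly). scalar a * f"
  by unfold_locales
     (simp_all add: scalar_def smult_add_right smult_add_left single_add mult_single mult.commute)

definition is_grading ::
  "('v, 'k::field) S poly set \<Rightarrow> (nat \<Rightarrow> ('v, 'k) S poly set) \<Rightarrow> bool" where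
  "is_grading A Gr \<longleftrightarrow>
     (\<forall>i. K_space.subspace (Gr i) \<and> Gr i \<subseteq> A) \<and>
     1 \<in> Gr 0 \<and>
     (\<forall>i j. \<forall>f\<in>Gr i. \<forall>g\<in>Gr j. f * g \<in> Gr (i + j)) \<and>
     (\<forall>f\<in>A. \<exists>!u. (\<forall>i. u i \<in> Gr i) \<and> finite {i. u i \<noteq> 0} \<and> f = (\<Sum>i | u i \<noteq> 0. u i))"

text \<open>
  The grading of the vertex cover algebra is pinned down by giving degree 1 to the variables
  and to all \<open>m\<^sub>C t\<close>, because these elements generate the algebra over \<open>K\<close>.
\<close>

definition is_standard_grading ::
  "'v graph \<Rightarrow> (nat \<Rightarrow> ('v, 'k::field) S poly set) \<Rightarrow> bool" where
  "is_standard_grading G Gr \<longleftrightarrow>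
     is_grading (vertex_cover_algebra G) Gr \<and>
     (\<forall>v\<in>fst G. [:variable v:] \<in> Gr 1) \<and>
     (\<forall>C. is_minimal_vertex_cover G C \<longrightarrow> monom (cover_monomial C) 1 \<in> Gr 1)"

definition hilbert_series :: "(nat \<Rightarrow> ('v, 'k::field) S poly set) \<Rightarrow> int fps" where
  "hilbert_series Gr = Abs_fps (\<lambda>i. int (K_space.dim (Gr i)))"

text \<open>\<open>h(z)\<close> is the numerator in \<open>H(z) = h(z) / (1 - z)\<^sup>d\<close>; \<open>d\<close> is the Krull dimension.\<close>

definition is_h_polynomial ::
  "nat \<Rightarrow> (nat \<Rightarrow> ('v, 'k::field) S poly set) \<Rightarrow> int poly \<Rightarrow> bool" where
  "is_h_polynomial d Gr h \<longleftrightarrow> hilbert_series Gr * (1 - fps_X) ^ d = fps_of_poly h"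

definition unimodal :: "'a::linorder list \<Rightarrow> bool" where
  "unimodal xs \<longleftrightarrow>
     (\<exists>m. \<forall>i. Suc i < length xs \<longrightarrow>
        (i < m \<longrightarrow> xs ! i \<le> xs ! Suc i) \<and> (m \<le> i \<longrightarrow> xs ! Suc i \<le> xs ! i))"

section \<open>Existence of the standard grading\<close>

abbreviation cf :: "('v, 'k::field) S poly \<Rightarrow> nat \<Rightarrow> ('v \<Rightarrow>\<^sub>0 nat) \<Rightarrow> 'k" where
  "cf f k c \<equiv> Poly_Mapping.lookup (coeff f k) c"

lemma cf_eqI: "(\<And>k c. cf f k c = cf g k c) \<Longrightarrow> f = g"
  by (intro poly_eqI poly_mapping_eqI) auto

lemma cf_scalar_mult: "cf (scalar a * f) k c = a * cf f k c"
  by (simp add: scalar_def flip: mult_map_scale_conv_mult)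
     (simp add: Poly_Mapping.map.rep_eq when_def)

lemma cf_mult_nonzero:
  assumes "cf (f * g) k c \<noteq> 0"
  obtains i j a b where "k = i + j" "c = a + b" "cf f i a \<noteq> 0" "cf g j b \<noteq> 0"
proof -
  have "(\<Sum>i\<le>k. Poly_Mapping.lookup (coeff f i * coeff g (k - i)) c) \<noteq> 0"
    using assms by (simp add: coeff_mult lookup_sum)
  then obtain i where i: "i \<le> k" "c \<in> Poly_Mapping.keys (coeff f i * coeff g (k - i))"
    by (metis (no_types, lifting) atMost_iff in_keys_iff sum.neutral)
  with keys_mult obtain a b where "c = a + b"
      "a \<in> Poly_Mapping.keys (coeff f i)" "b \<in> Poly_Mapping.keys (coeff g (k - i))"
    by blast
  with i that[of i "k - i" a b] show thesis by (simp add: in_keys_iff)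
qed

lemma cf_restrict: "\<exists>g. \<forall>k c. cf g k c = (if Q k c then cf f k c else 0)"
proof -
  define h where "h k = Abs_poly_mapping (\<lambda>c. if Q k c then cf f k c else 0)" for k
  have fin: "finite {c. (if Q k c then cf f k c else 0) \<noteq> 0}" for k
    by (rule finite_subset[of _ "{c. cf f k c \<noteq> 0}"]) auto
  have h: "Poly_Mapping.lookup (h k) c = (if Q k c then cf f k c else 0)" for k c
    unfolding h_def using lookup_Abs_poly_mapping[OF fin] by simp
  have "h k = 0" if "k > degree f" for k
    using that by (intro poly_mapping_eqI) (simp add: h coeff_eq_0)
  then have "coeff (Abs_poly h) = h" by (rule coeff_Abs_poly)
  with h show ?thesis by (intro exI[of _ "Abs_poly h"]) simp
qed

lemma cf_finite: "finite {(k, c). cf f k c \<noteq> 0}"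
proof (rule finite_subset)
  show "{(k, c). cf f k c \<noteq> 0} \<subseteq> Sigma {..degree f} (\<lambda>k. Poly_Mapping.keys (coeff f k))"
    by (auto simp: in_keys_iff intro!: le_degree)
qed auto

lemma is_k_cover_add:
  assumes a: "is_k_cover G i a" and b: "is_k_cover G j b"
  shows "is_k_cover G (i + j) (a + b)"
  unfolding is_k_cover_def lookup_add
proof (intro conjI allI impI)
  have "Poly_Mapping.keys a \<subseteq> fst G" "Poly_Mapping.keys b \<subseteq> fst G"
    using a b by (simp_all add: is_k_cover_def)
  then show "Poly_Mapping.keys (a + b) \<subseteq> fst G"
    using keys_add[of a b] by (meson Un_least order_trans)
  fix v w assume e: "{v, w} \<in> snd G"
  have "i \<le> Poly_Mapping.lookup a v + Poly_Mapping.lookup a w"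
      "j \<le> Poly_Mapping.lookup b v + Poly_Mapping.lookup b w"
    using a b e by (simp_all add: is_k_cover_def)
  then show "i + j \<le> Poly_Mapping.lookup a v + Poly_Mapping.lookup b v +
      (Poly_Mapping.lookup a w + Poly_Mapping.lookup b w)" by linarith
qed

lemma is_subalgebra_sum:
  assumes "is_subalgebra B" "\<And>x. x \<in> I \<Longrightarrow> f x \<in> B"
  shows "sum f I \<in> B"
proof -
  have "(0::('a, 'b) S poly) = scalar 0" by (simp add: scalar_def)
  then have "0 \<in> B" using assms(1) unfolding is_subalgebra_def by auto
  then show ?thesis using assms
    by (induction I rule: infinite_finite_induct) (auto simp: is_subalgebra_def)
qed

lemma is_subalgebra_vertex_cover_algebra: "is_subalgebra (vertex_cover_algebra G)"
  unfolding vertex_cover_algebra_def by (rule hull_in) (auto simp: is_subalgebra_def)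

lemma vertex_cover_algebra_eq:
  "vertex_cover_algebra G = {f. \<forall>k c. cf f k c \<noteq> 0 \<longrightarrow> is_k_cover G k c}" (is "_ = ?B")
proof
  show "vertex_cover_algebra G \<subseteq> ?B"
    unfolding vertex_cover_algebra_def
  proof (rule hull_minimal)
    show "{monom (monomial c) k | c k. is_k_cover G k c} \<subseteq> ?B"
      by (auto simp: monomial_def coeff_monom lookup_single when_def split: if_splits)
    have "scalar a \<in> ?B" for a
      by (auto simp: scalar_def coeff_pCons lookup_single when_def is_k_cover_def
               split: nat.splits if_splits)
    moreover have "f + g \<in> ?B" if "f \<in> ?B" "g \<in> ?B" for f g
      using that by (auto simp: lookup_add) (metis add.right_neutral)
    moreover have "f * g \<in> ?B" if "f \<in> ?B" "g \<in> ?B" for f g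
      using that by (auto elim!: cf_mult_nonzero intro: is_k_cover_add)
    ultimately show "is_subalgebra ?B" unfolding is_subalgebra_def by blast
  qed
  show "?B \<subseteq> vertex_cover_algebra G"
  proof
    fix f assume f: "f \<in> ?B"
    let ?I = "{(k, c). cf f k c \<noteq> 0}"
    have "f = (\<Sum>(k, c)\<in>?I. scalar (cf f k c) * monom (monomial c) k)" (is "_ = ?s")
    proof (rule cf_eqI)
      fix k c
      have "cf ?s k c = (\<Sum>x\<in>?I. if x = (k, c) then cf f k c else 0)"
        unfolding coeff_sum lookup_sum
        by (intro sum.cong)
           (auto simp: cf_scalar_mult monomial_def lookup_single when_def split: if_splits)
      then show "cf f k c = cf ?s k c" using cf_finite[of f] by (simp add: sum.delta)
    qed
    moreover have "scalar (cf f k c) * monom (monomial c) k \<in> vertex_cover_algebra G"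
      if "(k, c) \<in> ?I" for k c
    proof -
      have "monom (monomial c) k \<in> vertex_cover_algebra G"
        unfolding vertex_cover_algebra_def by (rule hull_inc) (use that f in auto)
      then show ?thesis
        using is_subalgebra_vertex_cover_algebra[of G] unfolding is_subalgebra_def by blast
    qed
    then have "?s \<in> vertex_cover_algebra G"
      by (intro is_subalgebra_sum is_subalgebra_vertex_cover_algebra) auto
    ultimately show "f \<in> vertex_cover_algebra G" by simp
  qed
qed

lemma cover_monomial_eq:
  "cover_monomial C = monomial (\<Sum>v\<in>C. Poly_Mapping.single v 1)"
  unfolding cover_monomial_def variable_def monomial_def
  by (induction C rule: infinite_finite_induct) (auto simp: mult_single)

lemma lookup_indicator:
  "finite C \<Longrightarrow> Poly_Mapping.lookup (\<Sum>v\<in>C. Poly_Mapping.single v 1) w = (if w \<in> C then 1 else (0::nat))"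
  by (simp add: lookup_sum lookup_single when_def sum.delta)

lemma is_k_cover_indicator:
  assumes "finite C" "is_vertex_cover G C"
  shows "is_k_cover G 1 (\<Sum>v\<in>C. Poly_Mapping.single v 1)"
  unfolding is_k_cover_def
proof (intro conjI allI impI)
  show "Poly_Mapping.keys (\<Sum>v\<in>C. Poly_Mapping.single v (1::nat)) \<subseteq> fst G"
    using assms(2) unfolding is_vertex_cover_def
    unfolding subset_iff in_keys_iff lookup_indicator[OF assms(1)] by simp
  fix v w assume e: "{v, w} \<in> snd G"
  have "\<forall>e\<in>snd G. e \<inter> C \<noteq> {}" using assms(2) by (simp add: is_vertex_cover_def)
  from bspec[OF this e] have "{v, w} \<inter> C \<noteq> {}" .
  then have "v \<in> C \<or> w \<in> C" by auto
  then show "1 \<le> Poly_Mapping.lookup (\<Sum>v\<in>C. Poly_Mapping.single v (1::nat)) v +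
      Poly_Mapping.lookup (\<Sum>v\<in>C. Poly_Mapping.single v 1) w"
    unfolding lookup_indicator[OF assms(1)] by auto
qed

lemma card_minimal_vertex_cover:
  assumes po: "partial_order_on P r" and p: "bij_betw p {1..n} P"
    and C: "is_minimal_vertex_cover (poset_graph n p r) C"
  shows "finite C" "card C = n"
proof -
  let ?G = "poset_graph n p r"
  have cov: "C \<subseteq> X ` {1..n} \<union> Y ` {1..n}"
    and edge: "\<And>i j. i \<in> {1..n} \<Longrightarrow> j \<in> {1..n} \<Longrightarrow> (p i, p j) \<in> r \<Longrightarrow> X i \<in> C \<or> Y j \<in> C"
    using C unfolding is_minimal_vertex_cover_def is_vertex_cover_def poset_graph_def by auto
  show fin: "finite C" by (rule finite_subset[OF cov]) auto
  have refl: "(p i, p i) \<in> r" if "i \<in> {1..n}" for i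
    using po p that unfolding partial_order_on_def preorder_on_def bij_betw_def
    by (auto simp: refl_on_def)
  have tr: "trans r" using po unfolding partial_order_on_def preorder_on_def by auto
  have min: "\<exists>e\<in>snd ?G. e \<inter> (C - {v}) = {}" if "v \<in> C" for v
  proof -
    have "\<not> is_vertex_cover ?G (C - {v})"
      using C that unfolding is_minimal_vertex_cover_def by blast
    moreover have "C - {v} \<subseteq> fst ?G" using cov by (auto simp: poset_graph_def)
    ultimately show ?thesis unfolding is_vertex_cover_def by blast
  qed
  have excl: "\<not> (X i \<in> C \<and> Y i \<in> C)" for i
  proof
    assume "X i \<in> C \<and> Y i \<in> C"
    with min obtain e e' where e: "e \<in> snd ?G" "e \<inter> (C - {X i}) = {}"
        "e' \<in> snd ?G" "e' \<inter> (C - {Y i}) = {}" by blast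
    have meet: "e \<inter> C \<noteq> {}" "e' \<inter> C \<noteq> {}"
      using C e unfolding is_minimal_vertex_cover_def is_vertex_cover_def by auto
    obtain j where j: "j \<in> {1..n}" "i \<in> {1..n}" "(p i, p j) \<in> r" "Y j \<notin> C"
      using e(1,2) meet(1) unfolding poset_graph_def by auto
    obtain l where l: "l \<in> {1..n}" "(p l, p i) \<in> r" "X l \<notin> C"
      using e(3,4) meet(2) unfolding poset_graph_def by auto
    have "(p l, p j) \<in> r" using tr l j by (blast dest: transD)
    with edge l j show False by blast
  qed
  have "bij_betw (\<lambda>v. case v of X i \<Rightarrow> i | Y i \<Rightarrow> i) C {1..n}"
    unfolding bij_betw_def
  proof
    show "inj_on (\<lambda>v. case v of X i \<Rightarrow> i | Y i \<Rightarrow> i) C"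
      using excl by (auto intro!: inj_onI split: vertex.splits)
    have "i \<in> (\<lambda>v. case v of X i \<Rightarrow> i | Y i \<Rightarrow> i) ` C" if "i \<in> {1..n}" for i
      using edge[OF that that refl[OF that]] by force
    then show "(\<lambda>v. case v of X i \<Rightarrow> i | Y i \<Rightarrow> i) ` C = {1..n}"
      using cov by (auto split: vertex.splits)
  qed
  then show "card C = n" using bij_betw_same_card by fastforce
qed

lemma standard_grading_exists:
  assumes po: "partial_order_on P r" and p: "bij_betw p {1..n} P"
  shows "\<exists>Gr :: nat \<Rightarrow> (vertex, 'k::field) S poly set. is_standard_grading (poset_graph n p r) Gr"
proof -
  let ?G = "poset_graph n p r"
  let ?A = "vertex_cover_algebra ?G :: (vertex, 'k) S poly set"
  define d where "d c = (\<Sum>v\<in>fst ?G. Poly_Mapping.lookup c v)" for c :: "vertex \<Rightarrow>\<^sub>0 nat"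
  define w where "w k c = d c + k - n * k" for k c
  have finV: "finite (fst ?G)" by (simp add: poset_graph_def)
  have d_ge: "n * k \<le> d c" if "is_k_cover ?G k c" for k c
  proof -
    have "(p i, p i) \<in> r" if "i \<in> {1..n}" for i
      using po p that unfolding partial_order_on_def preorder_on_def bij_betw_def
      by (auto simp: refl_on_def)
    then have "{X i, Y i} \<in> snd ?G" if "i \<in> {1..n}" for i
      using that by (auto simp: poset_graph_def)
    then have ge: "k \<le> Poly_Mapping.lookup c (X i) + Poly_Mapping.lookup c (Y i)" if "i \<in> {1..n}" for i
      using that \<open>is_k_cover ?G k c\<close> unfolding is_k_cover_def by blast
    have "d c = (\<Sum>i\<in>{1..n}. Poly_Mapping.lookup c (X i) + Poly_Mapping.lookup c (Y i))"
      unfolding d_def poset_graph_def fst_conv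
      by (subst sum.union_disjoint) (auto simp: sum.reindex inj_on_def sum.distrib)
    also have "\<dots> \<ge> (\<Sum>i\<in>{1..n}. k)"
      by (intro sum_mono ge)
    finally show ?thesis by simp
  qed
  have w_add: "w (i + j) (a + b) = w i a + w j b" if "is_k_cover ?G i a" "is_k_cover ?G j b" for i j a b
  proof -
    have "d (a + b) = d a + d b" unfolding d_def by (simp add: lookup_add sum.distrib)
    then show ?thesis using d_ge[OF that(1)] d_ge[OF that(2)] unfolding w_def
      by (simp add: algebra_simps)
  qed
  define Gr where "Gr i = {f \<in> ?A. \<forall>k c. cf f k c \<noteq> 0 \<longrightarrow> w k c = i}" for i
  have A: "f \<in> ?A \<longleftrightarrow> (\<forall>k c. cf f k c \<noteq> 0 \<longrightarrow> is_k_cover ?G k c)" for f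
    unfolding vertex_cover_algebra_eq by simp
  have sub: "K_space.subspace (Gr i)" for i
    unfolding K_space.subspace_def Gr_def A
    by (auto simp: cf_scalar_mult lookup_add) (metis add.right_neutral)+
  have one: "1 \<in> Gr 0"
    unfolding Gr_def A
    by (auto simp: coeff_pCons one_pCons lookup_one when_def is_k_cover_def w_def d_def
             split: nat.splits if_splits)
  have mult: "f * g \<in> Gr (i + j)" if "f \<in> Gr i" "g \<in> Gr j" for f g i j
    using that unfolding Gr_def A by (auto elim!: cf_mult_nonzero simp: w_add intro: is_k_cover_add)
  have dec: "\<exists>!u. (\<forall>i. u i \<in> Gr i) \<and> finite {i. u i \<noteq> 0} \<and> f = (\<Sum>i | u i \<noteq> 0. u i)"
    if f: "f \<in> ?A" for f
  proof (rule ex_ex1I)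
    have "\<forall>i. \<exists>g. \<forall>k c. cf g k c = (if w k c = i then cf f k c else 0)"
      by (intro allI cf_restrict)
    then obtain u where u: "\<And>i k c. cf (u i) k c = (if w k c = i then cf f k c else 0)"
      by metis
    have "u i \<in> Gr i" for i using f unfolding Gr_def A by (auto simp: u)
    moreover have fin: "finite {i. u i \<noteq> 0}"
    proof (rule finite_subset)
      show "{i. u i \<noteq> 0} \<subseteq> (\<lambda>(k, c). w k c) ` {(k, c). cf f k c \<noteq> 0}"
      proof
        fix i assume "i \<in> {i. u i \<noteq> 0}"
        then obtain k c where "cf (u i) k c \<noteq> 0" using cf_eqI[of "u i" 0] by auto
        then show "i \<in> (\<lambda>(k, c). w k c) ` {(k, c). cf f k c \<noteq> 0}"
          by (auto simp: u split: if_splits)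
      qed
    qed (use cf_finite in auto)
    moreover have "f = (\<Sum>i | u i \<noteq> 0. u i)"
    proof (rule cf_eqI)
      fix k c
      have "cf (\<Sum>i | u i \<noteq> 0. u i) k c = (if u (w k c) \<noteq> 0 then cf f k c else 0)"
        using fin by (simp add: coeff_sum lookup_sum u sum.delta')
      moreover have "cf f k c = 0" if "u (w k c) = 0"
        using u[of "w k c" k c] that by simp
      ultimately show "cf f k c = cf (\<Sum>i | u i \<noteq> 0. u i) k c" by auto
    qed
    ultimately show "\<exists>u. (\<forall>i. u i \<in> Gr i) \<and> finite {i. u i \<noteq> 0} \<and> f = (\<Sum>i | u i \<noteq> 0. u i)"
      by blast
  next
    have key: "cf (u i) k c = (if w k c = i then cf f k c else 0)"
      if u: "(\<forall>i. u i \<in> Gr i) \<and> finite {i. u i \<noteq> 0} \<and> f = (\<Sum>i | u i \<noteq> 0. u i)" for u i k c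
    proof -
      have z: "cf (u j) k c = (if w k c = j then cf (u (w k c)) k c else 0)" for j
        using u unfolding Gr_def by auto
      have "cf f k c = (\<Sum>j | u j \<noteq> 0. cf (u j) k c)"
        using u by (metis (no_types) coeff_sum lookup_sum)
      also have "\<dots> = (\<Sum>j | u j \<noteq> 0. if w k c = j then cf (u (w k c)) k c else 0)"
        by (intro sum.cong refl z)
      also have "\<dots> = cf (u (w k c)) k c"
        using u by (simp add: sum.delta')
      finally have "cf f k c = cf (u (w k c)) k c" .
      then show ?thesis by (subst z) (simp only:)
    qed
    fix u v
    assume "(\<forall>i. u i \<in> Gr i) \<and> finite {i. u i \<noteq> 0} \<and> f = (\<Sum>i | u i \<noteq> 0. u i)"
      and "(\<forall>i. v i \<in> Gr i) \<and> finite {i. v i \<noteq> 0} \<and> f = (\<Sum>i | v i \<noteq> 0. v i)"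
    from key[OF this(1)] key[OF this(2)] show "u = v"
      by (intro ext cf_eqI) simp
  qed
  have mon: "monom (monomial c) k \<in> Gr 1" if "is_k_cover ?G k c" "w k c = 1" for k c
    using that unfolding Gr_def A
    by (auto simp: monomial_def coeff_monom lookup_single when_def split: if_splits)
  have var: "[:variable v:] \<in> Gr 1" if "v \<in> fst ?G" for v
  proof -
    have "d (Poly_Mapping.single v 1) = 1"
      using that finV unfolding d_def by (simp add: lookup_single when_def sum.delta)
    then show ?thesis
      using mon[of 0 "Poly_Mapping.single v 1"] that
      by (simp add: variable_def w_def is_k_cover_def monom_0)
  qed
  have cov: "monom (cover_monomial C) 1 \<in> Gr 1" if C: "is_minimal_vertex_cover ?G C" for C
  proof -
    have fin: "finite C" and card: "card C = n" using card_minimal_vertex_cover[OF po p C] .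
    have vc: "is_vertex_cover ?G C" using C by (simp add: is_minimal_vertex_cover_def)
    then have "C \<subseteq> fst ?G" by (simp add: is_vertex_cover_def)
    then have "d (\<Sum>v\<in>C. Poly_Mapping.single v 1) = n"
      unfolding d_def lookup_indicator[OF fin] using finV card
      by (simp add: sum.If_cases Int_absorb1)
    then show ?thesis
      using mon[OF is_k_cover_indicator[OF fin vc]] by (simp add: cover_monomial_eq w_def)
  qed
  have "Gr i \<subseteq> ?A" for i by (auto simp: Gr_def)
  then show ?thesis
    unfolding is_standard_grading_def is_grading_def
    by (intro exI[of _ Gr] conjI allI ballI impI sub one mult dec var cov) assumption+
qed

end

theory Submission
  imports Defs
begin

text \<open>
  Every \<open>k\<close>-cover is, in a unique way, the sum of a cover with \<open>b j\<close> at \<open>X j\<close> and \<open>k - b j\<close> at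
  \<open>Y j\<close>, where \<open>b\<close> is an order reversing map into \<open>{0..k}\<close>, and of an arbitrary vector supported
  on all the \<open>Y j\<close> and on those \<open>X j\<close> for which \<open>b j\<close> is as large as \<open>k\<close> and the values of \<open>b\<close>
  strictly below \<open>j\<close> permit; one takes \<open>b j\<close> to be the minimum of \<open>k\<close> and of the values at \<open>X i\<close> for
  \<open>i\<close> below or equal to \<open>j\<close>.  Since the grading is forced, the Hilbert series is a
  sum over \<open>k\<close> and \<open>b\<close> of \<open>z\<^sup>k\<close> times powers of \<open>1 / (1 - z)\<close>.  Let \<open>m\<close> be the last element of the
  poset.  Splitting the remaining elements into those with value below \<open>b m\<close>, which form an upset
  \<open>F\<close>, and the others gives a recursion of the form
  \<open>h(Q \<union> {m}) = (1 + z) h(Q) + z \<Sum>\<^sub>F h(Q - F) h'(F)\<close>, with a similar recursion for \<open>h'\<close>.  It preserves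
  nonnegative combinations of the polynomials \<open>z\<^sup>j (1 + z)\<^sup>e\<close> with \<open>2 j + e\<close> fixed, and such
  combinations are symmetric and unimodal.
\<close>

section \<open>Sums of power series\<close>

definition geo :: "int fps" where "geo = Abs_fps (\<lambda>_. 1)"

lemma geo_inverse: "geo * (1 - fps_X) = 1"
proof (rule fps_ext)
  fix m show "(geo * (1 - fps_X)) $ m = 1 $ m"
    by (cases m) (auto simp: geo_def algebra_simps)
qed

lemma geo_unfold: "geo = 1 + fps_X * geo"
  using geo_inverse by (simp add: algebra_simps)

text \<open>The sum of \<open>z^k f k\<close> over all \<open>k\<close>, where \<open>z\<close> is
  \<open>fps_X\<close>. It is given through its coefficients, which are finite sums, so no
  convergence is involved.\<close>

definition bisum :: "(nat \<Rightarrow> int fps) \<Rightarrow> int fps" where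
  "bisum f = Abs_fps (\<lambda>m. \<Sum>k\<le>m. f k $ (m - k))"

text \<open>Terms with \<open>k > m\<close> do not reach the coefficient at \<open>m\<close>.
  Identities for \<open>bisum\<close> thus reduce to identities of finite sums with one common
  truncation bound.\<close>

lemma bisum_nth: "m \<le> M \<Longrightarrow> bisum f $ m = (\<Sum>k\<le>M. fps_X ^ k * f k) $ m"
proof -
  assume "m \<le> M"
  then have "(\<Sum>k\<le>M. if m < k then 0 else f k $ (m - k)) = (\<Sum>k\<le>m. f k $ (m - k))"
    by (intro sum.mono_neutral_cong_right) auto
  then show ?thesis by (simp add: bisum_def fps_sum_nth fps_X_power_mult_nth)
qed

lemma fps_mult_nth_cong:
  assumes "\<And>i. i \<le> m \<Longrightarrow> a $ i = a' $ i" "\<And>i. i \<le> m \<Longrightarrow> b $ i = b' $ i"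
  shows "(a * b) $ m = (a' * b') $ (m::nat)"
  using assms by (auto simp: fps_mult_nth intro!: sum.cong)

lemma bisum_add: "bisum (\<lambda>k. f k + g k) = bisum f + bisum g"
  by (rule fps_ext) (simp add: bisum_def sum.distrib)

lemma bisum_sum: "bisum (\<lambda>k. \<Sum>x\<in>A. f x k) = (\<Sum>x\<in>A. bisum (f x))"
proof (rule fps_ext)
  fix m
  show "bisum (\<lambda>k. \<Sum>x\<in>A. f x k) $ m = (\<Sum>x\<in>A. bisum (f x)) $ m"
    by (simp add: bisum_def fps_sum_nth sum.swap[of _ _ A])
qed

lemma bisum_cmult: "bisum (\<lambda>k. c * f k) = c * bisum f"
proof (rule fps_ext)
  fix m
  have "(c * bisum f) $ m = (c * (\<Sum>k\<le>m. fps_X ^ k * f k)) $ m"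
    by (intro fps_mult_nth_cong) (simp_all add: bisum_nth)
  also have "\<dots> = bisum (\<lambda>k. c * f k) $ m"
    by (simp add: bisum_nth[OF order_refl] sum_distrib_left mult.left_commute)
  finally show "bisum (\<lambda>k. c * f k) $ m = (c * bisum f) $ m" by simp
qed

lemma bisum_conv: "bisum (\<lambda>k. \<Sum>i\<le>k. f i * g (k - i)) = bisum f * bisum g"
proof (rule fps_ext)
  fix m
  have "(bisum f * bisum g) $ m =
      ((\<Sum>k\<le>m. fps_X ^ k * f k) * (\<Sum>k\<le>m. fps_X ^ k * g k)) $ m"
    by (intro fps_mult_nth_cong) (simp_all add: bisum_nth)
  also have "\<dots> = (\<Sum>(i, j)\<in>{..m} \<times> {..m}. (fps_X ^ (i + j) * (f i * g j)) $ m)"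
    by (simp add: sum_product sum.cartesian_product fps_sum_nth power_add mult_ac split_def)
  \<comment> \<open>Pairs with \<open>i + j > m\<close> only carry powers of \<open>z\<close> beyond
    \<open>m\<close>; the remaining triangle is then summed along the diagonals
    \<open>i + j = k\<close>.\<close>
  also have "\<dots> = (\<Sum>(i, j)\<in>{(i, j). i + j \<le> m}. (f i * g j) $ (m - (i + j)))"
    by (intro sum.mono_neutral_cong_right) (auto simp: fps_X_power_mult_nth split: if_splits)
  also have "\<dots> = (\<Sum>k\<le>m. \<Sum>i\<le>k. (f i * g (k - i)) $ (m - k))"
    by (simp add: sum.triangle_reindex_eq)
  also have "\<dots> = bisum (\<lambda>k. \<Sum>i\<le>k. f i * g (k - i)) $ m"
    by (simp add: bisum_def fps_sum_nth)
  finally show "bisum (\<lambda>k. \<Sum>i\<le>k. f i * g (k - i)) $ m = (bisum f * bisum g) $ m" by simp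
qed

lemma bisum_shift: "bisum (\<lambda>k. if k = 0 then 0 else f (k - 1)) = fps_X * bisum f"
proof (rule fps_ext)
  fix m
  show "bisum (\<lambda>k. if k = 0 then 0 else f (k - 1)) $ m = (fps_X * bisum f) $ m"
    by (cases m) (simp_all add: bisum_def sum.atMost_Suc_shift del: sum.atMost_Suc)
qed

text \<open>In the recursion below, a threshold \<open>t\<close> splits the range
  \<open>{0..k}\<close> into \<open>{0..t-1}\<close> and \<open>{t..k}\<close>. Moved to start at 0,
  the two parts have upper bounds adding up to \<open>k - 1\<close>; the lost unit is the factor
  \<open>fps_X\<close>.\<close>

lemma bisum_conv_shift:
  "bisum (\<lambda>k. \<Sum>t\<in>{1..k}. f (k - t) * g (t - 1)) = fps_X * (bisum f * bisum g)"
proof -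
  have "(\<Sum>t\<in>{1..k}. f (k - t) * g (t - 1)) =
      (if k = 0 then 0 else (\<Sum>i\<le>k - 1. f i * g (k - 1 - i)))" for k
  proof (cases "k = 0")
    case False
    then have "(\<Sum>t\<in>{1..k}. f (k - t) * g (t - 1)) = (\<Sum>i\<le>k - 1. f i * g (k - 1 - i))"
      by (intro sum.reindex_bij_witness[of _ "\<lambda>i. k - i" "\<lambda>t. k - t"]) auto
    with False show ?thesis by simp
  qed simp
  then show ?thesis
    by (simp only: bisum_shift[of "\<lambda>k. \<Sum>i\<le>k. f i * g (k - i)"] bisum_conv)
qed

lemma bisum_one: "bisum (\<lambda>_. 1) = geo"
proof (rule fps_ext)
  fix m :: nat
  have "(\<Sum>k\<le>m. if m - k = 0 then 1 else 0) = (\<Sum>k\<in>{m}. 1::int)"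
    by (intro sum.mono_neutral_cong_right) auto
  then show "bisum (\<lambda>_. 1) $ m = geo $ m" by (simp add: bisum_def geo_def)
qed

section \<open>Gamma-positive polynomials\<close>

text \<open>The index \<open>d\<close> is twice the center of symmetry and need not be the degree.
  Closure under addition supplies all nonnegative integer multiples, so no coefficients
  appear.\<close>

inductive gamma_positive :: "nat \<Rightarrow> int poly \<Rightarrow> bool" where
  zero: "gamma_positive d 0"
| basis: "gamma_positive (2 * j + e) (monom 1 j * [:1, 1:] ^ e)"
| add: "gamma_positive d f \<Longrightarrow> gamma_positive d g \<Longrightarrow> gamma_positive d (f + g)"

text \<open>A product of two basis elements is again a basis element; additivity does the
  rest.\<close>

lemma gamma_positive_basis_mult:
  assumes "gamma_positive d f"
  shows "gamma_positive (2 * j + e + d) (monom 1 j * [:1, 1:] ^ e * f)"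
  using assms
proof induction
  case (basis i l)
  have "monom 1 j * [:1, 1:] ^ e * (monom 1 i * [:1, 1:] ^ l) =
      (monom 1 j * monom 1 i) * [:1, 1:] ^ (e + l)"
    by (simp only: power_add mult_ac)
  also have "\<dots> = monom (1::int) (j + i) * [:1, 1:] ^ (e + l)"
    by (simp add: mult_monom)
  finally have "monom 1 j * [:1, 1:] ^ e * (monom 1 i * [:1, 1:] ^ l) =
      monom (1::int) (j + i) * [:1, 1:] ^ (e + l)" .
  then show ?case using gamma_positive.basis[of "j + i" "e + l"] by (simp add: algebra_simps)
qed (auto simp: algebra_simps intro: gamma_positive.intros)

lemma gamma_positive_mult:
  assumes "gamma_positive d f" "gamma_positive d' g"
  shows "gamma_positive (d + d') (f * g)"
  using assms(1)
proof induction
  case (basis j e)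
  then show ?case using gamma_positive_basis_mult[OF assms(2)] by simp
qed (auto simp: algebra_simps intro: gamma_positive.intros)

lemma gamma_positive_sum:
  "(\<And>x. x \<in> A \<Longrightarrow> gamma_positive d (f x)) \<Longrightarrow> gamma_positive d (sum f A)"
  by (induction A rule: infinite_finite_induct) (auto intro: gamma_positive.intros)

lemma gamma_positive_1: "gamma_positive 0 1"
  using basis[of 0 0] by simp

lemma coeff_one_plus_X_power: "coeff ([:1, 1:] ^ e) i = int (e choose i)"
  by (cases "i \<le> e") (simp_all add: coeff_linear_poly_power coeff_eq_0 degree_linear_power binomial_eq_0)

text \<open>For fixed \<open>d\<close> all three properties pass to sums, so only basis elements
  matter; there they are symmetry and monotonicity of binomial coefficients.\<close>

lemma gamma_positive_coeff:
  assumes "gamma_positive d f"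
  shows "(\<forall>i>d. coeff f i = 0) \<and> (\<forall>i\<le>d. coeff f (d - i) = coeff f i) \<and>
    (\<forall>i. 2 * i + 1 \<le> d \<longrightarrow> coeff f i \<le> coeff f (Suc i))"
  using assms
proof induction
  case (basis j e)
  have c: "coeff (monom 1 j * [:1, 1:] ^ e) i = (if i < j then 0 else int (e choose (i - j)))" for i
    by (simp add: coeff_monom_mult coeff_one_plus_X_power)
  have "e choose (j + e - i) = e choose (i - j)" if "j \<le> i" "i \<le> j + e" for i
    using that binomial_symmetric[of "i - j" e] by (simp add: algebra_simps)
  moreover have "e choose (i - j) \<le> e choose (Suc i - j)" if "j \<le> i" "2 * i + 1 \<le> 2 * j + e" for i
  \<comment> \<open>In this case the two coefficients are the equal central ones of an odd row, and
    monotonicity up to the middle does not reach the second of them.\<close>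
  proof (cases "e = Suc (2 * (i - j))")
    case True
    then have "e - (i - j) = Suc i - j" "i - j \<le> e" using that by simp_all
    then show ?thesis using binomial_symmetric[of "i - j" e] by (metis order_refl)
  next
    case False
    then show ?thesis using that binomial_mono[of "i - j" "Suc i - j" e] by (simp add: Suc_diff_le)
  qed
  ultimately show ?case unfolding c by (auto simp: algebra_simps)
qed (auto intro!: add_mono)

lemma gamma_positive_unimodal:
  assumes "gamma_positive d f"
  shows "unimodal (coeffs f)"
proof (cases "f = 0")
  case False
  note * = gamma_positive_coeff[OF assms]
  have deg: "degree f \<le> d" using * by (intro degree_le) auto
  show ?thesis unfolding unimodal_def
  proof (intro exI[of _ "d div 2"] allI impI conjI)
    fix i assume i: "Suc i < length (coeffs f)"
    then have le: "Suc i \<le> d" using deg False by (simp add: length_coeffs_degree)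
    have nth: "coeffs f ! i = coeff f i" "coeffs f ! Suc i = coeff f (Suc i)"
      using i False by (simp_all add: coeffs_nth length_coeffs_degree)
    show "coeffs f ! i \<le> coeffs f ! Suc i" if "i < d div 2"
      unfolding nth using * that by auto
    \<comment> \<open>Symmetry reflects the descent at \<open>i\<close> to the ascent at
      \<open>d - Suc i\<close>, which lies in the first half.\<close>
    assume "d div 2 \<le> i"
    then have "2 * (d - Suc i) + 1 \<le> d" using le by linarith
    then have "coeff f (d - Suc i) \<le> coeff f (Suc (d - Suc i))" using * by blast
    moreover have "Suc (d - Suc i) = d - i" using le by simp
    ultimately show "coeffs f ! Suc i \<le> coeffs f ! i"
      unfolding nth using * le by (metis Suc_leD)
  qed
qed (simp add: unimodal_def)

section \<open>Enumeration of order reversing maps\<close>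

text \<open>\<open>R\<close> stands for a strict order. The value 0 outside \<open>Q\<close> makes
  each map on \<open>Q\<close> a single function, so that counting is possible.\<close>

definition order_reversing :: "(nat \<Rightarrow> nat \<Rightarrow> bool) \<Rightarrow> nat set \<Rightarrow> nat \<Rightarrow> (nat \<Rightarrow> nat) set" where
  "order_reversing R Q k = {b. (\<forall>i. i \<notin> Q \<longrightarrow> b i = 0) \<and> (\<forall>i\<in>Q. b i \<le> k) \<and>
     (\<forall>i\<in>Q. \<forall>j\<in>Q. R i j \<longrightarrow> b j \<le> b i)}"

text \<open>
  The flag \<open>\<beta>\<close> says whether \<open>Q\<close> is thought of as having an additional bottom element,
  at which \<open>b\<close> takes the value \<open>k\<close>.
\<close>

definition tight :: "(nat \<Rightarrow> nat \<Rightarrow> bool) \<Rightarrow> bool \<Rightarrow> nat set \<Rightarrow> nat \<Rightarrow> (nat \<Rightarrow> nat) \<Rightarrow> nat set" where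
  "tight R \<beta> Q k b = {j\<in>Q. (\<beta> \<and> b j = k) \<or> (\<exists>i\<in>Q. R i j \<and> b i = b j)}"

text \<open>A tight element will be one whose \<open>X\<close> coordinate can be raised freely; it
  contributes a factor \<open>1 / (1 - z)\<close>.\<close>

definition enum :: "(nat \<Rightarrow> nat \<Rightarrow> bool) \<Rightarrow> bool \<Rightarrow> nat set \<Rightarrow> nat \<Rightarrow> int fps" where
  "enum R \<beta> Q k = (\<Sum>b\<in>order_reversing R Q k. geo ^ card (tight R \<beta> Q k b))"

text \<open>The candidates for the set of elements of \<open>Q\<close> with value below that of a
  new last element \<open>n\<close>: closed upwards because values decrease, and free of elements
  under \<open>n\<close>, whose values are at least that at \<open>n\<close>.\<close>

definition upsets :: "(nat \<Rightarrow> nat \<Rightarrow> bool) \<Rightarrow> nat set \<Rightarrow> nat \<Rightarrow> nat set set" where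
  "upsets R Q n = {F. F \<subseteq> Q \<and> (\<forall>i\<in>F. \<forall>j\<in>Q. R i j \<longrightarrow> j \<in> F) \<and> (\<forall>i\<in>F. \<not> R i n)}"

lemma finite_order_reversing: "finite Q \<Longrightarrow> finite (order_reversing R Q k)"
  by (rule finite_subset[OF _ finite_set_of_finite_funs[of Q "{..k}" 0]])
     (auto simp: order_reversing_def)

lemma finite_upsets: "finite Q \<Longrightarrow> finite (upsets R Q n)"
  by (rule finite_subset[of _ "Pow Q"]) (auto simp: upsets_def)

lemma finite_tight: "finite Q \<Longrightarrow> finite (tight R \<beta> Q k b)"
  by (auto simp: tight_def)

lemma enum_empty: "enum R \<beta> {} k = 1"
proof -
  have "order_reversing R {} k = {\<lambda>_. 0}" by (auto simp: order_reversing_def)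
  then show ?thesis by (simp add: enum_def tight_def)
qed

text \<open>The upset consists of the elements with value below the threshold \<open>t\<close>.\<close>

lemma enum_threshold:
  assumes fin: "finite Q" and t: "1 \<le> t" "t \<le> k"
  shows "(\<Sum>b | b \<in> order_reversing R Q k \<and> (\<forall>i\<in>Q. R i n \<longrightarrow> t \<le> b i).
           geo ^ card (tight R \<beta> Q k b)) =
         (\<Sum>F\<in>upsets R Q n. enum R \<beta> (Q - F) (k - t) * enum R False F (t - 1))"
proof -
  let ?B = "order_reversing R"
  let ?A = "SIGMA F:upsets R Q n. ?B (Q - F) (k - t) \<times> ?B F (t - 1)"
  \<comment> \<open>Values on \<open>F\<close> lie in \<open>{0..t-1}\<close> and are kept; values
    on \<open>Q - F\<close> lie in \<open>{t..k}\<close> and are stored after subtracting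
    \<open>t\<close>. The map \<open>cut\<close> recovers \<open>F\<close> as the place where
    \<open>b\<close> is below \<open>t\<close>.\<close>
  define glue where "glue = (\<lambda>(F, b1, b2) i. if i \<in> F then b2 i else if i \<in> Q then b1 i + t else (0::nat))"
  define cut where "cut b = ({i\<in>Q. b i < t}, \<lambda>i. if i \<in> Q \<and> \<not> b i < t then b i - t else 0,
     \<lambda>i. if i \<in> Q \<and> b i < t then b i else 0)" for b :: "nat \<Rightarrow> nat"
  have "(\<Sum>F\<in>upsets R Q n. enum R \<beta> (Q - F) (k - t) * enum R False F (t - 1)) =
      (\<Sum>(F, b1, b2)\<in>?A. geo ^ (card (tight R \<beta> (Q - F) (k - t) b1) + card (tight R False F (t - 1) b2)))"
    using fin
    by (subst sum.Sigma[symmetric])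
       (auto simp: enum_def sum_product sum.cartesian_product power_add finite_upsets upsets_def split_def
             intro!: finite_order_reversing sum.cong dest: finite_subset)
  also have "\<dots> = (\<Sum>b | b \<in> ?B Q k \<and> (\<forall>i\<in>Q. R i n \<longrightarrow> t \<le> b i). geo ^ card (tight R \<beta> Q k b))"
  proof (rule sum.reindex_bij_witness[of _ cut glue])
    fix x assume x: "x \<in> ?A"
    then obtain F b1 b2 where xe: "x = (F, b1, b2)" and F: "F \<in> upsets R Q n"
      and b1: "b1 \<in> ?B (Q - F) (k - t)" and b2: "b2 \<in> ?B F (t - 1)" by auto
    have FQ: "F \<subseteq> Q" using F by (simp add: upsets_def)
    have b1_le: "b1 i \<le> k - t" for i
      using b1 unfolding order_reversing_def by (cases "i \<in> Q - F") auto
    have b2_lt: "b2 i < t" for i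
      using b2 t unfolding order_reversing_def by (cases "i \<in> F") force+
    have g: "glue x i = (if i \<in> F then b2 i else if i \<in> Q then b1 i + t else 0)" for i
      by (simp add: xe glue_def)
    have lt: "glue x i < t \<longleftrightarrow> i \<in> F" if "i \<in> Q" for i using that b2_lt by (simp add: g)
    have "glue x i \<le> k" for i using b1_le[of i] b2_lt[of i] t by (auto simp: g le_diff_conv2)
    moreover have "glue x j \<le> glue x i" if "i \<in> Q" "j \<in> Q" "R i j" for i j
    proof -
      have "i \<in> F \<Longrightarrow> j \<in> F" using F that by (auto simp: upsets_def)
      moreover have "b2 j \<le> b2 i" if "i \<in> F" "j \<in> F"
        using b2 that \<open>R i j\<close> by (auto simp: order_reversing_def)
      moreover have "b1 j \<le> b1 i" if "i \<notin> F" "j \<notin> F"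
        using b1 that \<open>R i j\<close> \<open>i \<in> Q\<close> \<open>j \<in> Q\<close> by (auto simp: order_reversing_def)
      ultimately show ?thesis using that b2_lt[of j] by (auto simp: g)
    qed
    ultimately have "glue x \<in> ?B Q k" using FQ by (auto simp: order_reversing_def g)
    moreover have "t \<le> glue x i" if "i \<in> Q" "R i n" for i
      using F that by (auto simp: upsets_def g)
    ultimately show "glue x \<in> {b \<in> ?B Q k. \<forall>i\<in>Q. R i n \<longrightarrow> t \<le> b i}" by blast
    have "{i \<in> Q. glue x i < t} = F" using lt FQ by auto
    moreover have "(\<lambda>i. if i \<in> Q \<and> \<not> glue x i < t then glue x i - t else 0) = b1"
      using b1 by (auto simp: order_reversing_def g b2_lt fun_eq_iff)
    moreover have "(\<lambda>i. if i \<in> Q \<and> glue x i < t then glue x i else 0) = b2"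
      using b2 FQ by (auto simp: order_reversing_def g b2_lt fun_eq_iff)
    ultimately have "cut (glue x) = (F, b1, b2)" by (simp only: cut_def)
    then show "cut (glue x) = x" by (simp only: xe)
    \<comment> \<open>Values on the two sides of the threshold never agree, so ties stay on one
      side. The value \<open>k\<close> occurs only outside \<open>F\<close>, hence
      \<open>Q - F\<close> inherits the flag and \<open>F\<close> gets \<open>False\<close>.\<close>
    have "tight R \<beta> Q k (glue x) = tight R \<beta> (Q - F) (k - t) b1 \<union> tight R False F (t - 1) b2"
    proof (rule set_eqI)
      fix j
      have *: "glue x i = glue x j \<longleftrightarrow> (if j \<in> F then i \<in> F \<and> b2 i = b2 j else i \<notin> F \<and> b1 i = b1 j)"
        if "i \<in> Q" "j \<in> Q" for i
        using that b2_lt[of i] b2_lt[of j] by (auto simp: g)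
      have "glue x j = k \<longleftrightarrow> j \<notin> F \<and> b1 j = k - t" if "j \<in> Q"
        using that b2_lt[of j] t by (auto simp: g)
      with * FQ show "j \<in> tight R \<beta> Q k (glue x) \<longleftrightarrow>
          j \<in> tight R \<beta> (Q - F) (k - t) b1 \<union> tight R False F (t - 1) b2"
        by (cases "j \<in> F") (auto simp: tight_def)
    qed
    moreover have "tight R \<beta> (Q - F) (k - t) b1 \<inter> tight R False F (t - 1) b2 = {}"
      by (auto simp: tight_def)
    ultimately have "card (tight R \<beta> Q k (glue x)) =
        card (tight R \<beta> (Q - F) (k - t) b1) + card (tight R False F (t - 1) b2)"
      using fin FQ by (simp add: card_Un_disjoint finite_tight finite_subset)
    then show "geo ^ card (tight R \<beta> Q k (glue x)) = (case x of (F, b1, b2) \<Rightarrow>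
        geo ^ (card (tight R \<beta> (Q - F) (k - t) b1) + card (tight R False F (t - 1) b2)))"
      by (simp add: xe)
  next
    fix b assume "b \<in> {b \<in> ?B Q k. \<forall>i\<in>Q. R i n \<longrightarrow> t \<le> b i}"
    then have b: "b \<in> ?B Q k" and n: "\<And>i. i \<in> Q \<Longrightarrow> R i n \<Longrightarrow> t \<le> b i" by auto
    show "glue (cut b) = b" using b by (auto simp: glue_def cut_def order_reversing_def fun_eq_iff)
    have "{i\<in>Q. b i < t} \<in> upsets R Q n"
      using b n by (force simp: upsets_def order_reversing_def)
    then show "cut b \<in> ?A"
      using b t by (fastforce simp: cut_def order_reversing_def intro: diff_le_mono)
  qed
  finally show ?thesis by simp
qed

text \<open>Given \<open>b\<close> on \<open>Q\<close>, the value at \<open>n\<close> runs through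
  \<open>0..T b\<close>, and \<open>n\<close> can be tight only at \<open>T b\<close>. As nothing
  lies above \<open>n\<close>, tightness in \<open>Q\<close> is unaffected. This yields one extreme
  weight and \<open>T b\<close> ordinary ones, which are counted by thresholds.\<close>

lemma enum_insert:
  assumes fin: "finite Q" and n: "n \<notin> Q" "\<And>j. j \<in> insert n Q \<Longrightarrow> \<not> R n j"
  shows "enum R \<beta> (insert n Q) k =
    (if \<beta> \<or> (\<exists>i\<in>Q. R i n) then geo else 1) * enum R \<beta> Q k +
    (\<Sum>F\<in>upsets R Q n. \<Sum>t\<in>{1..k}. enum R \<beta> (Q - F) (k - t) * enum R False F (t - 1))"
proof -
  let ?B = "order_reversing R" and ?c = "\<beta> \<or> (\<exists>i\<in>Q. R i n)"
  let ?w = "\<lambda>b. geo ^ card (tight R \<beta> Q k b)"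
  define T where "T b = Min (insert k (b ` {i\<in>Q. R i n}))" for b :: "nat \<Rightarrow> nat"
  have T_ge: "t \<le> T b \<longleftrightarrow> t \<le> k \<and> (\<forall>i\<in>Q. R i n \<longrightarrow> t \<le> b i)" for t b
    unfolding T_def using fin by (subst Min_ge_iff) auto
  have T_eq: "t = T b \<longleftrightarrow> t \<le> T b \<and> (t = k \<or> (\<exists>i\<in>Q. R i n \<and> b i = t))" for t b
  proof -
    have "T b \<in> insert k (b ` {i\<in>Q. R i n})" unfolding T_def using fin by (intro Min_in) auto
    moreover have "T b \<le> k" "\<And>i. i \<in> Q \<Longrightarrow> R i n \<Longrightarrow> T b \<le> b i" using T_ge[of "T b" b] by auto
    ultimately show ?thesis by (auto intro: antisym)
  qed
  have "enum R \<beta> (insert n Q) k =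
      (\<Sum>(b, t)\<in>(SIGMA b:?B Q k. {..T b}). ?w b * (if ?c \<and> t = T b then geo else 1))"
    unfolding enum_def
  proof (rule sum.reindex_bij_witness[of _ "\<lambda>(b, t). b(n := t)" "\<lambda>b. (b(n := 0), b n)"])
    fix b assume b: "b \<in> ?B (insert n Q) k"
    have bn: "b n \<le> T (b(n := 0))" using b n(1) by (auto simp: T_ge order_reversing_def)
    then show "(b(n := 0), b n) \<in> (SIGMA b:?B Q k. {..T b})"
      using b n(1) by (auto simp: order_reversing_def)
    have bk: "\<And>i. i \<in> Q \<Longrightarrow> b i \<le> k" using b by (auto simp: order_reversing_def)
    have eq: "?c \<and> b n = T (b(n := 0)) \<longleftrightarrow> \<beta> \<and> b n = k \<or> (\<exists>i\<in>Q. R i n \<and> b i = b n)"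
    proof -
      have "b n = T (b(n := 0)) \<longleftrightarrow> b n = k \<or> (\<exists>i\<in>Q. R i n \<and> (b(n := 0)) i = b n)"
        using T_eq[of "b n"] bn by blast
      also have "(\<exists>i\<in>Q. R i n \<and> (b(n := 0)) i = b n) \<longleftrightarrow> (\<exists>i\<in>Q. R i n \<and> b i = b n)"
        using n(1) by (intro bex_cong) auto
      finally have *: "b n = T (b(n := 0)) \<longleftrightarrow> b n = k \<or> (\<exists>i\<in>Q. R i n \<and> b i = b n)" .
      \<comment> \<open>If \<open>b n = k\<close>, all elements under \<open>n\<close> have value
        \<open>k\<close> too, so reaching the bound \<open>k\<close> is also a tie once such an
        element exists.\<close>
      have "b i = b n" if "i \<in> Q" "R i n" "b n = k" for i
        using bn[unfolded T_ge] bk[OF that(1)] that n(1) by (auto split: if_splits intro: antisym)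
      then show ?thesis unfolding * by blast
    qed
    have "tight R \<beta> (insert n Q) k b = tight R \<beta> Q k (b(n := 0)) \<union>
        (if ?c \<and> b n = T (b(n := 0)) then {n} else {})"
    proof (rule set_eqI)
      fix j
      have upd: "(b(n := 0)) i = b i" if "i \<in> Q" for i using n(1) that by auto
      have "(\<exists>i\<in>Q. R i j \<and> (b(n := 0)) i = (b(n := 0)) j) \<longleftrightarrow> (\<exists>i\<in>Q. R i j \<and> b i = b j)"
        if "j \<in> Q"
        using upd that by (intro bex_cong) auto
      then show "j \<in> tight R \<beta> (insert n Q) k b \<longleftrightarrow> j \<in> tight R \<beta> Q k (b(n := 0)) \<union>
          (if ?c \<and> b n = T (b(n := 0)) then {n} else {})"
        unfolding eq using n upd by (cases "j = n"; cases "j \<in> Q") (simp_all add: tight_def)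
    qed
    moreover have "n \<notin> tight R \<beta> Q k (b(n := 0))" using n(1) by (simp add: tight_def)
    ultimately show "(case (b(n := 0), b n) of (b, t) \<Rightarrow> ?w b * (if ?c \<and> t = T b then geo else 1)) =
        geo ^ card (tight R \<beta> (insert n Q) k b)"
      using fin by (simp add: finite_tight mult.commute)
  next
    fix x assume "x \<in> (SIGMA b:?B Q k. {..T b})"
    then show "(case x of (b, t) \<Rightarrow> b(n := t)) \<in> ?B (insert n Q) k"
      using n by (auto simp: order_reversing_def T_ge)
    show "((case x of (b, t) \<Rightarrow> b(n := t))(n := 0), (case x of (b, t) \<Rightarrow> b(n := t)) n) = x"
      using \<open>x \<in> _\<close> n(1) by (auto simp: order_reversing_def fun_eq_iff)
  qed (auto simp: fun_eq_iff)
  also have "\<dots> = (\<Sum>b\<in>?B Q k. ?w b * (\<Sum>t\<le>T b. if ?c \<and> t = T b then geo else 1))"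
    using fin by (subst sum.Sigma[symmetric]) (auto simp: finite_order_reversing sum_distrib_left)
  also have "\<dots> = (\<Sum>b\<in>?B Q k. (if ?c then geo else 1) * ?w b + (\<Sum>t | t \<in> {1..k} \<and> t \<le> T b. ?w b))"
  proof (intro sum.cong refl)
    fix b
    \<comment> \<open>Writing \<open>geo\<close> as \<open>1 + fps_X * geo\<close> makes all
      \<open>T b + 1\<close> terms equal to 1 up to one surplus \<open>fps_X * geo\<close>, which
      one of the units completes to \<open>geo\<close> again.\<close>
    have "(\<Sum>t\<le>T b. if ?c \<and> t = T b then geo else 1) =
        (\<Sum>t\<le>T b. 1 + (if t = T b then if ?c then fps_X * geo else 0 else 0))"
      using geo_unfold by (intro sum.cong) auto
    also have "\<dots> = of_nat (Suc (T b)) + (if ?c then fps_X * geo else 0)"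
      by (simp only: sum.distrib) simp
    also have "\<dots> = (if ?c then geo else 1) + of_nat (T b)"
      by (subst (2) geo_unfold) simp
    finally have *: "(\<Sum>t\<le>T b. if ?c \<and> t = T b then geo else 1) =
        (if ?c then geo else 1) + of_nat (T b)" .
    have range: "{t. t \<in> {1..k} \<and> t \<le> T b} = {1..T b}" using T_ge by auto
    show "?w b * (\<Sum>t\<le>T b. if ?c \<and> t = T b then geo else 1) =
        (if ?c then geo else 1) * ?w b + (\<Sum>t | t \<in> {1..k} \<and> t \<le> T b. ?w b)"
      unfolding * range by (simp add: algebra_simps)
  qed
  also have "\<dots> = (if ?c then geo else 1) * enum R \<beta> Q k +
      (\<Sum>b\<in>?B Q k. \<Sum>t | t \<in> {1..k} \<and> t \<le> T b. ?w b)"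
    by (simp add: sum.distrib enum_def sum_distrib_left)
  \<comment> \<open>Exchanging the sums fixes the threshold \<open>t\<close> first; by
    \<open>T_ge\<close> the inner sum then has the shape treated in
    \<open>enum_threshold\<close>.\<close>
  also have "(\<Sum>b\<in>?B Q k. \<Sum>t | t \<in> {1..k} \<and> t \<le> T b. ?w b) =
      (\<Sum>t\<in>{1..k}. \<Sum>b | b \<in> ?B Q k \<and> t \<le> T b. ?w b)"
    using fin by (intro sum.swap_restrict) (auto simp: finite_order_reversing)
  also have "\<dots> = (\<Sum>t\<in>{1..k}. \<Sum>b | b \<in> ?B Q k \<and> (\<forall>i\<in>Q. R i n \<longrightarrow> t \<le> b i). ?w b)"
    by (intro sum.cong) (auto simp: T_ge)
  also have "\<dots> = (\<Sum>t\<in>{1..k}. \<Sum>F\<in>upsets R Q n. enum R \<beta> (Q - F) (k - t) * enum R False F (t - 1))"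
    using fin by (intro sum.cong refl enum_threshold) auto
  also have "\<dots> = (\<Sum>F\<in>upsets R Q n. \<Sum>t\<in>{1..k}. enum R \<beta> (Q - F) (k - t) * enum R False F (t - 1))"
    by (rule sum.swap)
  finally show ?thesis .
qed

section \<open>The recursion for the generating functions and gamma-positivity\<close>

lemma bisum_enum_insert:
  assumes "finite Q" "n \<notin> Q" "\<And>j. j \<in> insert n Q \<Longrightarrow> \<not> R n j"
  shows "bisum (enum R \<beta> (insert n Q)) =
    (if \<beta> \<or> (\<exists>i\<in>Q. R i n) then geo else 1) * bisum (enum R \<beta> Q) +
    (\<Sum>F\<in>upsets R Q n. fps_X * (bisum (enum R \<beta> (Q - F)) * bisum (enum R False F)))"
proof -
  have "enum R \<beta> (insert n Q) = (\<lambda>k. (if \<beta> \<or> (\<exists>i\<in>Q. R i n) then geo else 1) * enum R \<beta> Q k +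
      (\<Sum>F\<in>upsets R Q n. \<Sum>t\<in>{1..k}. enum R \<beta> (Q - F) (k - t) * enum R False F (t - 1)))"
    by (intro ext enum_insert assms)
  then show ?thesis by (simp only: bisum_add bisum_cmult bisum_sum bisum_conv_shift)
qed

text \<open>Induction over proper subsets, splitting off the largest label, which is maximal for
  \<open>R\<close>. Without the flag the index is one lower; this difference truncates to 0 for the
  empty set, which is why trivial upsets are handled apart.\<close>

lemma bisum_enum_gamma_positive:
  assumes "finite A" "\<And>i j. i \<in> A \<Longrightarrow> j \<in> A \<Longrightarrow> R i j \<Longrightarrow> i < j"
  shows "\<exists>p. gamma_positive (card A - (if \<beta> then 0 else 1)) p \<and>
    bisum (enum R \<beta> A) = geo ^ Suc (card A) * fps_of_poly p"
  using assms
proof (induction A arbitrary: \<beta> rule: finite_psubset_induct)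
  case (psubset A)
  show ?case
  proof (cases "A = {}")
    case True
    then show ?thesis
      using gamma_positive_1 by (intro exI[of _ 1]) (simp add: enum_empty[abs_def] bisum_one)
  next
    case False
    define n where "n = Max A"
    define Q where "Q = A - {n}"
    have nA: "n \<in> A" and le: "\<And>i. i \<in> A \<Longrightarrow> i \<le> n"
      using psubset.hyps False by (simp_all add: n_def)
    have A: "A = insert n Q" and nQ: "n \<notin> Q" and finQ: "finite Q" and QA: "Q \<subset> A"
      using nA psubset.hyps by (auto simp: Q_def)
    have cardA: "card A = Suc (card Q)" using A nQ finQ by simp
    have max: "\<not> R n j" if "j \<in> insert n Q" for j
      using psubset.prems[of n j] le[of j] that nA A by force
    let ?g = "\<lambda>\<beta> F. bisum (enum R \<beta> F)" and ?d = "\<lambda>(\<beta>::bool) F. card F - (if \<beta> then 0 else 1::nat)"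
    have "\<forall>\<beta> F. \<exists>p. F \<subset> A \<longrightarrow> gamma_positive (?d \<beta> F) p \<and>
        ?g \<beta> F = geo ^ Suc (card F) * fps_of_poly p"
      using psubset.IH psubset.prems by (metis (no_types, lifting) psubsetD)
    then obtain p where p: "\<And>\<beta> F. F \<subset> A \<Longrightarrow> gamma_positive (?d \<beta> F) (p \<beta> F)"
        and gp: "\<And>\<beta> F. F \<subset> A \<Longrightarrow> ?g \<beta> F = geo ^ Suc (card F) * fps_of_poly (p \<beta> F)"
      by metis
    have g0: "?g \<beta> {} = geo" for \<beta> by (simp add: enum_empty[abs_def] bisum_one)
    have rec: "?g \<beta> A = (if \<beta> \<or> (\<exists>i\<in>Q. R i n) then geo else 1) * ?g \<beta> Q +
        (\<Sum>F\<in>upsets R Q n. fps_X * (?g \<beta> (Q - F) * ?g False F))"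
      unfolding A by (intro bisum_enum_insert finQ nQ max)
    have e: "{} \<in> upsets R Q n" by (simp add: upsets_def)
    have finU: "finite (upsets R Q n)" by (rule finite_upsets[OF finQ])
    \<comment> \<open>The upsets removed here contribute multiples of \<open>?g \<beta> Q\<close>,
      which merge with the leading term into \<open>(1 + fps_X) * geo * ?g \<beta> Q\<close>. They
      are the ones for which the index of a piece would be truncated.\<close>
    define U where "U = upsets R Q n - (if \<beta> then {{}} else {{}, Q})"
    show ?thesis
    \<comment> \<open>For a single element without the flag, \<open>{}\<close> and \<open>Q\<close>
      are the same upset and cannot be taken out as two terms.\<close>
    proof (cases "\<not> \<beta> \<and> Q = {}")
      case True
      then have "upsets R Q n = {{}}" by (auto simp: upsets_def)
      then have "?g \<beta> A = geo * (1 + fps_X * geo)" using rec True by (simp add: g0 algebra_simps)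
      then have "?g \<beta> A = geo ^ 2" by (simp add: geo_unfold[symmetric] power2_eq_square)
      then show ?thesis using gamma_positive_1 True A
        by (intro exI[of _ 1]) (simp add: power2_eq_square)
    next
      case False
      have "?g \<beta> A = (1 + fps_X) * geo * ?g \<beta> Q + (\<Sum>F\<in>U. fps_X * (?g \<beta> (Q - F) * ?g False F))"
      proof (cases "\<beta> \<or> (\<exists>i\<in>Q. R i n)")
        case True
        then have "U = upsets R Q n - {{}}" by (auto simp: U_def upsets_def)
        then show ?thesis using rec True
          by (simp add: sum.remove[OF finU e] g0 algebra_simps)
      next
        case minimal: False
        with False have U: "U = upsets R Q n - {{}} - {Q}" and Q: "Q \<in> upsets R Q n - {{}}"
          by (auto simp: U_def upsets_def)
        have "?g \<beta> A = ?g \<beta> Q + (fps_X * (?g \<beta> Q * geo) + (fps_X * (geo * ?g \<beta> Q) +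
            (\<Sum>F\<in>U. fps_X * (?g \<beta> (Q - F) * ?g False F))))"
          using rec minimal finU Q unfolding U
          by (simp add: sum.remove[OF finU e] sum.remove[OF _ Q] g0)
        also have "\<dots> = (1 + fps_X * geo + fps_X * geo) * ?g \<beta> Q +
            (\<Sum>F\<in>U. fps_X * (?g \<beta> (Q - F) * ?g False F))"
          by (simp add: algebra_simps)
        \<comment> \<open>The two copies of \<open>fps_X * geo\<close> stem from the upsets
          \<open>{}\<close> and \<open>Q\<close>; one of them completes 1 to
          \<open>geo\<close>.\<close>
        also have "1 + fps_X * geo + fps_X * geo = (1 + fps_X) * geo"
          by (simp only: geo_unfold[symmetric] distrib_right mult_1_left)
        finally show ?thesis .
      qed
      also have "\<dots> = geo ^ Suc (card A) * fps_of_poly ([:1, 1:] * p \<beta> Q +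
          (\<Sum>F\<in>U. monom 1 1 * (p \<beta> (Q - F) * p False F)))"
      proof -
        have "fps_X * (?g \<beta> (Q - F) * ?g False F) =
            geo ^ Suc (card A) * (fps_X * (fps_of_poly (p \<beta> (Q - F)) * fps_of_poly (p False F)))"
          if "F \<in> U" for F
        proof -
          have F: "F \<subseteq> Q" "F \<subset> A" "Q - F \<subset> A" using that QA by (auto simp: U_def upsets_def)
          have "card Q = card (Q - F) + card F"
            using F finQ by (simp add: card_Diff_subset card_mono finite_subset)
          then show ?thesis by (simp add: gp F cardA power_add algebra_simps)
        qed
        then show ?thesis
          by (simp add: gp[OF QA] cardA fps_of_poly_add fps_of_poly_mult fps_of_poly_sum
              fps_of_poly_pCons fps_of_poly_monom' sum_distrib_left distrib_left algebra_simps
              cong: sum.cong)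
      qed
      finally have eq: "?g \<beta> A = \<dots>" .
      have gp1: "gamma_positive (?d \<beta> A) ([:1, 1:] * p \<beta> Q)"
      proof -
        have "\<beta> \<or> card Q > 0" using False finQ by (simp add: card_gt_0_iff)
        then have "1 + ?d \<beta> Q = ?d \<beta> A" using cardA by auto
        then show ?thesis
          using gamma_positive_mult[OF basis[of 0 1] p[OF QA, of \<beta>]] by simp
      qed
      have gp2: "gamma_positive (?d \<beta> A) (monom 1 1 * (p \<beta> (Q - F) * p False F))" if "F \<in> U" for F
      proof -
        have F: "F \<subseteq> Q" "F \<subset> A" "Q - F \<subset> A" "F \<noteq> {}" "\<beta> \<or> F \<noteq> Q"
          using that QA by (auto simp: U_def upsets_def split: if_splits)
        have "card Q = card (Q - F) + card F"
          using F finQ by (simp add: card_Diff_subset card_mono finite_subset)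
        moreover have "card F > 0" using F finQ finite_subset by (auto simp: card_gt_0_iff)
        moreover have "\<beta> \<or> card (Q - F) > 0" using F finQ by (auto simp: card_gt_0_iff)
        \<comment> \<open>The factor \<open>monom 1 1\<close> has index 2. With the flag only
          \<open>F\<close> loses 1, without it both pieces do, and nonemptiness excludes
          truncation.\<close>
        ultimately have "2 + (?d \<beta> (Q - F) + ?d False F) = ?d \<beta> A" using cardA by auto
        then show ?thesis
          using gamma_positive_mult[OF basis[of 1 0] gamma_positive_mult[OF p[OF F(3), of \<beta>] p[OF F(2), of False]]]
          by simp
      qed
      show ?thesis
        by (rule exI, rule conjI[OF gamma_positive.add[OF gp1 gamma_positive_sum[OF gp2]] eq])
    qed
  qed
qed

section \<open>Counting exponent vectors by total degree\<close>

definition vectors :: "'v set \<Rightarrow> nat \<Rightarrow> ('v \<Rightarrow>\<^sub>0 nat) set" where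
  "vectors V m = {x. Poly_Mapping.keys x \<subseteq> V \<and> (\<Sum>v\<in>V. Poly_Mapping.lookup x v) = m}"

text \<open>Splitting off the entry at one element turns the count into a partial sum of the
  previous counts, which is multiplication by \<open>geo\<close>.\<close>

lemma finite_card_vectors:
  assumes "finite V"
  shows "finite (vectors V m) \<and> int (card (vectors V m)) = (geo ^ card V) $ m"
  using assms
proof (induction V arbitrary: m)
  case empty
  have "vectors ({} :: 'a set) m = (if m = 0 then {0} else {})" by (auto simp: vectors_def)
  then show ?case by (cases "m = 0") simp_all
next
  case (insert v V)
  let ?A = "SIGMA t:{..m}. vectors V (m - t)"
  have bij: "bij_betw (\<lambda>(t, x). Poly_Mapping.single v t + x) ?A (vectors (insert v V) m)"
  proof (rule bij_betw_byWitness[where f' = "\<lambda>y. (Poly_Mapping.lookup y v, Poly_Mapping.update v 0 y)"])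
    have out: "Poly_Mapping.lookup x v = 0" if "Poly_Mapping.keys x \<subseteq> V" for x :: "'a \<Rightarrow>\<^sub>0 nat"
      using that insert.hyps by (auto simp: in_keys_iff subset_iff)
    show "\<forall>a\<in>?A. (\<lambda>y. (Poly_Mapping.lookup y v, Poly_Mapping.update v 0 y))
        (case a of (t, x) \<Rightarrow> Poly_Mapping.single v t + x) = a"
      by (auto simp: vectors_def lookup_add out lookup_update lookup_single when_def
          intro!: poly_mapping_eqI)
    show "\<forall>y\<in>vectors (insert v V) m. (case (Poly_Mapping.lookup y v, Poly_Mapping.update v 0 y) of
        (t, x) \<Rightarrow> Poly_Mapping.single v t + x) = y"
      by (auto simp: lookup_add lookup_update lookup_single when_def intro!: poly_mapping_eqI)
    have s1: "(\<Sum>w\<in>V. (if v = w then t else 0) + Poly_Mapping.lookup x w) =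
        (\<Sum>w\<in>V. Poly_Mapping.lookup x w)" for t x
      using insert.hyps by (intro sum.cong) auto
    have s2: "(\<Sum>w\<in>V. if v = w then 0 else Poly_Mapping.lookup x w) =
        (\<Sum>w\<in>V. Poly_Mapping.lookup x w)" for x :: "'a \<Rightarrow>\<^sub>0 nat"
      using insert.hyps by (intro sum.cong) auto
    show "(\<lambda>(t, x). Poly_Mapping.single v t + x) ` ?A \<subseteq> vectors (insert v V) m"
      using insert.hyps
      by (auto simp: vectors_def s1 out lookup_add in_keys_iff subset_iff lookup_single when_def
          split: if_splits)
    show "(\<lambda>y. (Poly_Mapping.lookup y v, Poly_Mapping.update v 0 y)) ` vectors (insert v V) m \<subseteq> ?A"
      using insert.hyps
      by (auto simp: vectors_def s2 in_keys_iff subset_iff lookup_update split: if_splits) blast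
  qed
  have "finite ?A" using insert.IH by auto
  moreover have "int (card ?A) = (\<Sum>t\<le>m. (geo ^ card V) $ (m - t))"
    using insert.IH by simp
  ultimately show ?case
    using bij_betw_finite[OF bij] bij_betw_same_card[OF bij] insert.hyps
    by (simp add: fps_mult_nth geo_def[THEN arg_cong, of "\<lambda>f. f $ _"] atLeast0AtMost)
qed

section \<open>Covers and order reversing maps\<close>

locale natural_poset =
  fixes n :: nat and p :: "nat \<Rightarrow> 'a" and r :: "'a rel"
  assumes refl: "i \<in> {1..n} \<Longrightarrow> (p i, p i) \<in> r"
    and tr: "trans r"
    and natural: "i \<in> {1..n} \<Longrightarrow> j \<in> {1..n} \<Longrightarrow> (p i, p j) \<in> r \<Longrightarrow> i \<le> j"
begin

abbreviation "N \<equiv> {1..n}"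
abbreviation "le i j \<equiv> (p i, p j) \<in> r"
abbreviation "below i j \<equiv> le i j \<and> i \<noteq> j"
abbreviation "cover \<equiv> is_k_cover (poset_graph n p r)"
abbreviation "verts \<equiv> X ` N \<union> Y ` N"

text \<open>The degree of \<open>x^c t^k\<close>: each \<open>m_C t\<close> uses \<open>n\<close>
  variables and one \<open>t\<close> but has degree 1, so every \<open>t\<close> counts as
  \<open>1 - n\<close>. By \<open>cover_sum_ge\<close> the subtraction does not truncate on
  covers.\<close>

definition weight :: "nat \<Rightarrow> (vertex \<Rightarrow>\<^sub>0 nat) \<Rightarrow> nat" where
  "weight k c = (\<Sum>v\<in>verts. Poly_Mapping.lookup c v) + k - n * k"

text \<open>The largest order reversing map into \<open>{0..k}\<close> bounded by \<open>c\<close>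
  on the vertices \<open>X j\<close>. The cap \<open>k\<close> acts like a bottom element of value
  \<open>k\<close>, hence the flag \<open>True\<close> below.\<close>

definition floor_cover :: "nat \<Rightarrow> (vertex \<Rightarrow>\<^sub>0 nat) \<Rightarrow> nat \<Rightarrow> nat" where
  "floor_cover k c j = (if j \<in> N
     then Min (insert k ((\<lambda>i. Poly_Mapping.lookup c (X i)) ` {i\<in>N. le i j})) else 0)"

definition base :: "nat \<Rightarrow> (nat \<Rightarrow> nat) \<Rightarrow> vertex \<Rightarrow>\<^sub>0 nat" where
  "base k b = (\<Sum>j\<in>N. Poly_Mapping.single (X j) (b j) + Poly_Mapping.single (Y j) (k - b j))"

text \<open>The coordinates that can be raised without changing \<open>floor_cover\<close>:
  \<open>Y j\<close> does not enter it, and raising \<open>X j\<close> is harmless when a tie or the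
  cap already determines the value at \<open>j\<close>.\<close>

definition slots :: "nat \<Rightarrow> (nat \<Rightarrow> nat) \<Rightarrow> vertex set" where
  "slots k b = X ` tight below True N k b \<union> Y ` N"

lemma le_trans: "le i j \<Longrightarrow> le j l \<Longrightarrow> le i l"
  using tr by (blast dest: transD)

lemma cover_iff:
  "cover k c \<longleftrightarrow> Poly_Mapping.keys c \<subseteq> verts \<and>
     (\<forall>i\<in>N. \<forall>j\<in>N. le i j \<longrightarrow> k \<le> Poly_Mapping.lookup c (X i) + Poly_Mapping.lookup c (Y j))"
  unfolding is_k_cover_def poset_graph_def by (auto simp: doubleton_eq_iff add.commute)

lemma sum_verts: "(\<Sum>v\<in>verts. f v) = (\<Sum>j\<in>N. f (X j) + (f (Y j)::nat))"
  by (subst sum.union_disjoint) (auto simp: sum.reindex inj_on_def sum.distrib)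

text \<open>The edges joining \<open>X j\<close> with \<open>Y j\<close> form a perfect matching,
  and each of them requires \<open>k\<close>.\<close>

lemma cover_sum_ge: "cover k c \<Longrightarrow> n * k \<le> (\<Sum>v\<in>verts. Poly_Mapping.lookup c v)"
proof -
  assume "cover k c"
  then have "(\<Sum>j\<in>N. k) \<le> (\<Sum>v\<in>verts. Poly_Mapping.lookup c v)"
    unfolding sum_verts by (intro sum_mono) (auto simp: cover_iff refl)
  then show ?thesis by simp
qed

lemma lookup_base:
  "Poly_Mapping.lookup (base k b) (X j) = (if j \<in> N then b j else 0)"
  "Poly_Mapping.lookup (base k b) (Y j) = (if j \<in> N then k - b j else 0)"
  by (simp_all add: base_def lookup_sum lookup_add lookup_single when_def sum.delta)

lemma floor_cover_ge:
  "j \<in> N \<Longrightarrow> t \<le> floor_cover k c j \<longleftrightarrow>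
     t \<le> k \<and> (\<forall>i\<in>N. le i j \<longrightarrow> t \<le> Poly_Mapping.lookup c (X i))"
  unfolding floor_cover_def by (simp only: if_True, subst Min_ge_iff) auto

lemma floor_cover_in:
  "j \<in> N \<Longrightarrow> floor_cover k c j = k \<or>
     (\<exists>i\<in>N. le i j \<and> floor_cover k c j = Poly_Mapping.lookup c (X i))"
proof -
  assume "j \<in> N"
  moreover have "Min (insert k ((\<lambda>i. Poly_Mapping.lookup c (X i)) ` {i\<in>N. le i j})) \<in>
      insert k ((\<lambda>i. Poly_Mapping.lookup c (X i)) ` {i\<in>N. le i j})"
    by (intro Min_in) auto
  ultimately show ?thesis by (auto simp: floor_cover_def)
qed

lemma floor_cover_antimono:
  assumes "i \<in> N" "j \<in> N" "le i j"
  shows "floor_cover k c j \<le> floor_cover k c i"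
  using floor_cover_ge[OF assms(2), of "floor_cover k c j" k c] le_trans assms
  by (subst floor_cover_ge) auto

lemma floor_cover_order_reversing: "floor_cover k c \<in> order_reversing below N k"
proof -
  have "floor_cover k c i \<le> k" if "i \<in> N" for i using floor_cover_ge[OF that] by blast
  then show ?thesis
    using floor_cover_antimono by (auto simp: order_reversing_def floor_cover_def[of _ _ i for i])
qed

text \<open>The minimum at \<open>j\<close> is attained at the cap or at \<open>X i\<close> for some
  \<open>i\<close> strictly below \<open>j\<close>. In the latter case the floor at \<open>i\<close>
  is squeezed between equal bounds, which gives a tie.\<close>

lemma floor_cover_tight:
  assumes j: "j \<in> N" and lt: "floor_cover k c j < Poly_Mapping.lookup c (X j)"
  shows "j \<in> tight below True N k (floor_cover k c)"
  using floor_cover_in[OF j, of k c]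
proof
  assume "\<exists>i\<in>N. le i j \<and> floor_cover k c j = Poly_Mapping.lookup c (X i)"
  then obtain i where i: "i \<in> N" "le i j" "floor_cover k c j = Poly_Mapping.lookup c (X i)" by blast
  have "floor_cover k c i \<le> floor_cover k c j"
    using floor_cover_ge[OF i(1), of "floor_cover k c i" k c] i refl by simp
  then have "floor_cover k c i = floor_cover k c j" using floor_cover_antimono[OF i(1) j i(2)] by (simp add: antisym)
  then show ?thesis using i j lt by (auto simp: tight_def)
qed (use j in \<open>auto simp: tight_def\<close>)

text \<open>Subtraction is pointwise and truncated, so the base has to lie under \<open>c\<close>.
  At \<open>Y j\<close> this holds because the floor is either \<open>k\<close> or the entry at some
  \<open>X i\<close> adjacent to \<open>Y j\<close>, where the cover condition applies.\<close>

lemma cover_decompose: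
  assumes c: "cover k c"
  shows "base k (floor_cover k c) + (c - base k (floor_cover k c)) = c"
    and "Poly_Mapping.keys (c - base k (floor_cover k c)) \<subseteq> slots k (floor_cover k c)"
proof -
  let ?b = "floor_cover k c"
  have X: "?b j \<le> Poly_Mapping.lookup c (X j)" if "j \<in> N" for j
    using floor_cover_ge[OF that, of "?b j" k c] refl that by blast
  have Y: "k - ?b j \<le> Poly_Mapping.lookup c (Y j)" if "j \<in> N" for j
    using floor_cover_in[OF that, of k c]
  proof
    assume "\<exists>i\<in>N. le i j \<and> ?b j = Poly_Mapping.lookup c (X i)"
    then obtain i where "i \<in> N" "le i j" "?b j = Poly_Mapping.lookup c (X i)" by blast
    moreover from this c that have "k \<le> Poly_Mapping.lookup c (X i) + Poly_Mapping.lookup c (Y j)"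
      unfolding cover_iff by blast
    ultimately show ?thesis by linarith
  qed simp
  have le: "Poly_Mapping.lookup (base k ?b) v \<le> Poly_Mapping.lookup c v" for v
    using X Y by (cases v) (auto simp: lookup_base)
  then show "base k ?b + (c - base k ?b) = c"
    by (intro poly_mapping_eqI) (simp add: lookup_add lookup_minus)
  show "Poly_Mapping.keys (c - base k ?b) \<subseteq> slots k ?b"
  proof
    fix v assume "v \<in> Poly_Mapping.keys (c - base k ?b)"
    then have *: "Poly_Mapping.lookup (base k ?b) v < Poly_Mapping.lookup c v"
      by (simp add: in_keys_iff lookup_minus)
    then have "v \<in> Poly_Mapping.keys c" by (simp add: in_keys_iff)
    then have "v \<in> verts" using c by (auto simp: cover_iff)
    with * show "v \<in> slots k ?b"
      by (auto simp: slots_def lookup_base simp del: One_nat_def intro!: imageI floor_cover_tight)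
  qed
qed

text \<open>This gives uniqueness of the decomposition. The floor is at least \<open>b\<close> since
  the base alone allows it; the upper bound goes by induction along the labels, as a tie at
  \<open>j\<close> refers to a smaller label.\<close>

lemma cover_compose:
  assumes b: "b \<in> order_reversing below N k" and x: "Poly_Mapping.keys x \<subseteq> slots k b"
  shows "cover k (base k b + x)" "floor_cover k (base k b + x) = b"
proof -
  let ?c = "base k b + x"
  have mono: "b j \<le> b i" if "i \<in> N" "j \<in> N" "le i j" for i j
    using b that by (cases "i = j") (auto simp: order_reversing_def)
  have bk: "b j \<le> k" if "j \<in> N" for j using b that by (auto simp: order_reversing_def)
  have slots: "slots k b \<subseteq> verts" by (auto simp: slots_def tight_def)
  show "cover k ?c"
    unfolding cover_iff
  proof (intro conjI ballI impI)
    show "Poly_Mapping.keys ?c \<subseteq> verts"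
    proof
      fix v assume "v \<in> Poly_Mapping.keys ?c"
      then have "Poly_Mapping.lookup (base k b) v \<noteq> 0 \<or> v \<in> Poly_Mapping.keys x"
        by (simp add: in_keys_iff lookup_add)
      then show "v \<in> verts" using x slots by (cases v) (auto simp: lookup_base split: if_splits)
    qed
    fix i j assume "i \<in> N" "j \<in> N" "le i j"
    with mono[of i j] bk[of j]
    show "k \<le> Poly_Mapping.lookup ?c (X i) + Poly_Mapping.lookup ?c (Y j)"
      by (simp add: lookup_add lookup_base)
  qed
  have "floor_cover k ?c j = b j" if "j \<in> N" for j
    using that
  proof (induction j rule: less_induct)
    case (less j)
    have "b j \<le> floor_cover k ?c j"
      using mono less.prems bk by (auto simp: floor_cover_ge lookup_add lookup_base intro: trans_le_add1)
    moreover have "floor_cover k ?c j \<le> b j"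
    proof (cases "j \<in> tight below True N k b")
      case True
      then consider "b j = k" | i where "i \<in> N" "below i j" "b i = b j" by (auto simp: tight_def)
      then show ?thesis
      proof cases
        case 1
        then show ?thesis using floor_cover_ge[OF less.prems] by blast
      next
        case 2
        then have "i < j" using natural[of i j] less.prems by auto
        then show ?thesis
          using less.IH[OF _ 2(1)] 2 floor_cover_antimono[of i j k ?c] less.prems by simp
      qed
    next
      case False
      then have "X j \<notin> Poly_Mapping.keys x" using x by (auto simp: slots_def)
      then have "Poly_Mapping.lookup ?c (X j) = b j"
        using less.prems by (simp add: lookup_add lookup_base in_keys_iff)
      then show ?thesis
        using floor_cover_ge[OF less.prems, of "floor_cover k ?c j" k ?c] refl[OF less.prems] less.prems
        by auto
    qed
    ultimately show ?case by simp
  qed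
  then show "floor_cover k ?c = b"
    using b by (auto simp: fun_eq_iff order_reversing_def floor_cover_def[of _ _ i for i])
qed

section \<open>Counting covers by weight\<close>

definition covers_of_weight :: "nat \<Rightarrow> (nat \<times> (vertex \<Rightarrow>\<^sub>0 nat)) set" where
  "covers_of_weight i = {(k, c). cover k c \<and> weight k c = i}"

text \<open>The base puts \<open>k\<close> on each matched pair, so it has weight \<open>k\<close>
  for every \<open>b\<close>; the excess supplies the remaining \<open>i - k\<close>.\<close>

lemma covers_of_weight_bij:
  "bij_betw (\<lambda>(k, b, x). (k, base k b + x))
     (SIGMA k:{..i}. SIGMA b:order_reversing below N k. vectors (slots k b) (i - k))
     (covers_of_weight i)"
proof (rule bij_betw_byWitness[where f' =
      "\<lambda>(k, c). (k, floor_cover k c, c - base k (floor_cover k c))"])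
  let ?A = "SIGMA k:{..i}. SIGMA b:order_reversing below N k. vectors (slots k b) (i - k)"
  have w: "(\<Sum>v\<in>verts. Poly_Mapping.lookup (base k b + x) v) =
      n * k + (\<Sum>v\<in>slots k b. Poly_Mapping.lookup x v)"
    if "b \<in> order_reversing below N k" "Poly_Mapping.keys x \<subseteq> slots k b" for k b x
  proof -
    have "(\<Sum>v\<in>verts. Poly_Mapping.lookup (base k b) v) = (\<Sum>j\<in>N. k)"
      unfolding sum_verts using that(1)
      by (intro sum.cong) (auto simp: lookup_base order_reversing_def)
    moreover have "(\<Sum>v\<in>verts. Poly_Mapping.lookup x v) = (\<Sum>v\<in>slots k b. Poly_Mapping.lookup x v)"
    proof (intro sum.mono_neutral_right ballI)
      show "slots k b \<subseteq> verts" by (auto simp: slots_def tight_def)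
      show "Poly_Mapping.lookup x v = 0" if "v \<in> verts - slots k b" for v
        using that \<open>Poly_Mapping.keys x \<subseteq> slots k b\<close> by (auto simp: in_keys_iff subset_iff)
    qed simp
    ultimately show ?thesis by (simp add: lookup_add sum.distrib)
  qed
  show "\<forall>a\<in>?A. (\<lambda>(k, c). (k, floor_cover k c, c - base k (floor_cover k c)))
      (case a of (k, b, x) \<Rightarrow> (k, base k b + x)) = a"
    by (auto simp: vectors_def cover_compose)
  show "\<forall>a'\<in>covers_of_weight i. (\<lambda>(k, b, x). (k, base k b + x))
      (case a' of (k, c) \<Rightarrow> (k, floor_cover k c, c - base k (floor_cover k c))) = a'"
    by (auto simp: covers_of_weight_def cover_decompose)
  show "(\<lambda>(k, b, x). (k, base k b + x)) ` ?A \<subseteq> covers_of_weight i"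
    by (auto simp: vectors_def covers_of_weight_def cover_compose weight_def w simp del: One_nat_def)
  have *: "k \<le> i \<and> (\<Sum>v\<in>slots k (floor_cover k c). Poly_Mapping.lookup (c - base k (floor_cover k c)) v) = i - k"
    if "cover k c" "weight k c = i" for k c
    using w[OF floor_cover_order_reversing cover_decompose(2)[OF that(1)]] that(2)
    unfolding cover_decompose(1)[OF that(1)] by (simp add: weight_def)
  show "(\<lambda>(k, c). (k, floor_cover k c, c - base k (floor_cover k c))) ` covers_of_weight i \<subseteq> ?A"
  proof (rule image_subsetI)
    fix a assume "a \<in> covers_of_weight i"
    then obtain k c where "a = (k, c)" "cover k c" "weight k c = i" by (auto simp: covers_of_weight_def)
    then show "(case a of (k, c) \<Rightarrow> (k, floor_cover k c, c - base k (floor_cover k c))) \<in> ?A"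
      using *[of k c] cover_decompose(2)[of k c] floor_cover_order_reversing[of k c]
      by (simp add: vectors_def)
  qed
qed

text \<open>The factor \<open>geo ^ n\<close> comes from the slots \<open>Y j\<close>, which are
  always free; the tight \<open>X j\<close> are recorded by \<open>enum\<close>.\<close>

lemma finite_card_covers_of_weight:
  shows "finite (covers_of_weight i)"
    and "int (card (covers_of_weight i)) = (geo ^ n * bisum (enum below True N)) $ i"
proof -
  let ?A = "SIGMA k:{..i}. SIGMA b:order_reversing below N k. vectors (slots k b) (i - k)"
  have fs: "finite (slots k b)" for k b by (simp add: slots_def finite_tight)
  have cs: "card (slots k b) = card (tight below True N k b) + n" for k b
    unfolding slots_def by (subst card_Un_disjoint) (auto simp: finite_tight card_image inj_on_def)
  note fv = finite_card_vectors[OF fs]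
  have "finite ?A" using fv by (auto intro!: finite_SigmaI finite_order_reversing)
  then show "finite (covers_of_weight i)" using bij_betw_finite[OF covers_of_weight_bij] by blast
  have "int (card (covers_of_weight i)) = int (card ?A)"
    using bij_betw_same_card[OF covers_of_weight_bij] by simp
  also have "\<dots> = (\<Sum>k\<le>i. \<Sum>b\<in>order_reversing below N k. (geo ^ (card (tight below True N k b) + n)) $ (i - k))"
    using fv by (simp add: finite_order_reversing cs)
  also have "\<dots> = bisum (\<lambda>k. geo ^ n * enum below True N k) $ i"
    by (simp add: bisum_def enum_def sum_distrib_left fps_sum_nth power_add mult.commute)
  finally show "int (card (covers_of_weight i)) = (geo ^ n * bisum (enum below True N)) $ i"
    by (simp add: bisum_cmult)
qed

end

section \<open>The graded pieces\<close>

lemma poly_expansion: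
  "f = (\<Sum>(k, c)\<in>{(k, c). cf f k c \<noteq> 0}. scalar (cf f k c) * monom (monomial c) k)" (is "_ = ?s")
proof (rule cf_eqI)
  fix k c
  have "cf ?s k c = (\<Sum>x\<in>{(k, c). cf f k c \<noteq> 0}. if x = (k, c) then cf f k c else 0)"
    unfolding coeff_sum lookup_sum
    by (intro sum.cong)
       (auto simp: cf_scalar_mult monomial_def lookup_single when_def split: if_splits)
  then show "cf f k c = cf ?s k c" using cf_finite[of f] by (simp add: sum.delta)
qed

lemma monomial_add: "monomial (a + b) = monomial a * monomial b"
  by (simp add: monomial_def mult_single)

lemma cf_monom: "cf (monom (monomial c) k) k' c' = (if k' = k \<and> c' = c then 1 else 0)"
  by (auto simp: monomial_def lookup_single when_def)

abbreviation cover_term :: "nat \<times> ('v \<Rightarrow>\<^sub>0 nat) \<Rightarrow> ('v, 'k::field) S poly" where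
  "cover_term \<equiv> \<lambda>(k, c). monom (monomial c) k"

lemma independent_cover_terms:
  fixes S :: "(nat \<times> ('v \<Rightarrow>\<^sub>0 nat)) set"
  assumes "finite S"
  shows "K_space.independent (cover_term ` S :: ('v, 'k::field) S poly set)"
    and "card (cover_term ` S :: ('v, 'k) S poly set) = card S"
proof -
  let ?t = "cover_term :: _ \<Rightarrow> ('v, 'k) S poly"
  have inj: "inj_on ?t S"
  proof (rule inj_onI, clarify)
    fix k l :: nat and c d :: "'v \<Rightarrow>\<^sub>0 nat"
    assume "monom (monomial c :: ('v, 'k) S) k = monom (monomial d) l"
    then have "cf (monom (monomial c :: ('v, 'k) S) k) k c = cf (monom (monomial d :: ('v, 'k) S) l) k c"
      by (simp only:)
    then show "k = l \<and> c = d" unfolding cf_monom by (simp split: if_splits)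
  qed
  then show "card (?t ` S) = card S" by (rule card_image)
  show "K_space.independent (?t ` S)"
  proof (rule K_space.independent_if_scalars_zero)
    show "finite (?t ` S)" using assms by simp
    fix u :: "('v, 'k) S poly \<Rightarrow> 'k" and x
    assume z: "(\<Sum>x\<in>?t ` S. scalar (u x) * x) = 0" and "x \<in> ?t ` S"
    then obtain k c where x: "x = monom (monomial c) k" and kc: "(k, c) \<in> S" by auto
    have "0 = cf (\<Sum>y\<in>S. scalar (u (?t y)) * ?t y) k c"
      using z inj by (simp add: sum.reindex)
    also have "\<dots> = (\<Sum>y\<in>S. if y = (k, c) then u x else 0)"
      unfolding coeff_sum lookup_sum
      by (intro sum.cong) (auto simp: cf_scalar_mult cf_monom x simp del: coeff_monom split: if_splits)
    finally show "u x = 0" using assms kc by simp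
  qed
qed

section \<open>Cover monomials as products of generators, and uniqueness of the grading\<close>

context natural_poset
begin

lemma fst_poset_graph: "fst (poset_graph n p r) = verts"
  by (simp add: poset_graph_def)

text \<open>The set holds exactly one end of each edge joining \<open>X i\<close> with
  \<open>Y i\<close>, so removing any vertex uncovers such an edge.\<close>

lemma minimal_cover_of_downset:
  assumes I: "I \<subseteq> N" "\<And>i j. i \<in> N \<Longrightarrow> j \<in> I \<Longrightarrow> le i j \<Longrightarrow> i \<in> I"
  shows "is_minimal_vertex_cover (poset_graph n p r) (X ` I \<union> Y ` (N - I))" (is "is_minimal_vertex_cover ?G ?C")
  unfolding is_minimal_vertex_cover_def
proof (intro conjI allI impI)
  show "is_vertex_cover ?G ?C"
    unfolding is_vertex_cover_def fst_poset_graph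
  proof (intro conjI ballI)
    show "?C \<subseteq> verts" using I(1) by blast
    fix e assume "e \<in> snd ?G"
    then obtain i j where e: "e = {X i, Y j}" "i \<in> N" "j \<in> N" "le i j"
      by (auto simp: poset_graph_def)
    then show "e \<inter> ?C \<noteq> {}" using I(2)[of i j] by (cases "j \<in> I") blast+
  qed
  fix D assume D: "D \<subset> ?C"
  then obtain v where v: "v \<in> ?C" "v \<notin> D" by blast
  from v(1) consider i where "i \<in> I" "v = X i" | i where "i \<in> N - I" "v = Y i" by blast
  then obtain i where i: "i \<in> N" "{X i, Y i} \<inter> D = {}"
  proof cases
    case (1 i)
    moreover have "Y i \<notin> D" using D 1 by blast
    ultimately show ?thesis using that[of i] I(1) v(2) by blast
  next
    case (2 i)
    moreover have "X i \<notin> D" using D 2 by blast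
    ultimately show ?thesis using that[of i] v(2) by blast
  qed
  moreover have "{X i, Y i} \<in> snd ?G" using i refl by (auto simp: poset_graph_def)
  ultimately show "\<not> is_vertex_cover ?G D" unfolding is_vertex_cover_def by blast
qed

lemma weight_add:
  assumes "cover k c" "cover l d"
  shows "weight (k + l) (c + d) = weight k c + weight l d"
  using cover_sum_ge[OF assms(1)] cover_sum_ge[OF assms(2)]
  by (simp add: weight_def lookup_add sum.distrib algebra_simps)

text \<open>Peeling off the minimal cover of the downset of all elements below which
  \<open>c\<close> does not vanish leaves a cover of one degree less.\<close>

lemma cover_peel:
  assumes c: "cover (Suc k) c"
  obtains C d where "is_minimal_vertex_cover (poset_graph n p r) C" "finite C" "card C = n"
    "C \<subseteq> verts" "cover k d" "c = (\<Sum>v\<in>C. Poly_Mapping.single v 1) + d"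
proof -
  define I where "I = {j\<in>N. \<forall>i\<in>N. le i j \<longrightarrow> Poly_Mapping.lookup c (X i) \<noteq> 0}"
  let ?C = "X ` I \<union> Y ` (N - I)"
  let ?u = "\<Sum>v\<in>?C. Poly_Mapping.single v (1::nat)"
  have fin: "finite ?C" by (simp add: I_def)
  have IN: "I \<subseteq> N" by (auto simp: I_def)
  have cov: "Suc k \<le> Poly_Mapping.lookup c (X i) + Poly_Mapping.lookup c (Y j)"
    if "i \<in> N" "j \<in> N" "le i j" for i j
    using c that unfolding cover_iff by blast
  have X: "Poly_Mapping.lookup c (X i) \<noteq> 0" if "i \<in> I" for i
    using that refl by (auto simp: I_def)
  have Y: "Suc k \<le> Poly_Mapping.lookup c (Y j)" if "j \<in> N - I" for j
  proof -
    obtain i where "i \<in> N" "le i j" "Poly_Mapping.lookup c (X i) = 0"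
      using \<open>j \<in> N - I\<close> by (auto simp: I_def)
    then show ?thesis using cov[of i j] that by simp
  qed
  have Y0: "Poly_Mapping.lookup c (Y j) \<noteq> 0" if "j \<in> N - I" for j using Y[OF that] by simp
  have lu: "Poly_Mapping.lookup ?u v = (if v \<in> ?C then 1 else 0)" for v
    by (rule lookup_indicator[OF fin])
  have le: "Poly_Mapping.lookup ?u v \<le> Poly_Mapping.lookup c v" for v
    unfolding lu using X Y0 by (cases v) (auto simp: Suc_le_eq)
  have min: "is_minimal_vertex_cover (poset_graph n p r) ?C"
  proof (rule minimal_cover_of_downset[OF IN])
    fix i j assume "i \<in> N" "j \<in> I" "le i j"
    then show "i \<in> I" using le_trans by (auto simp: I_def)
  qed
  have card: "card ?C = n"
  proof -
    have "card ?C = card I + card (N - I)"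
      using IN by (subst card_Un_disjoint) (auto simp: card_image inj_on_def finite_subset)
    then show ?thesis
      using IN card_mono[OF _ IN] by (simp add: card_Diff_subset finite_subset)
  qed
  define d where "d = c - ?u"
  have ld: "Poly_Mapping.lookup d v = Poly_Mapping.lookup c v - (if v \<in> ?C then 1 else 0)" for v
    by (simp only: d_def lookup_minus lu)
  have d: "cover k d"
    unfolding cover_iff
  proof (intro conjI ballI impI)
    have "Poly_Mapping.keys d \<subseteq> Poly_Mapping.keys c"
      by (auto simp: in_keys_iff ld)
    then show "Poly_Mapping.keys d \<subseteq> verts" using c by (auto simp: cover_iff)
    fix i j assume ij: "i \<in> N" "j \<in> N" "le i j"
    show "k \<le> Poly_Mapping.lookup d (X i) + Poly_Mapping.lookup d (Y j)"
    proof (cases "j \<in> I")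
      case True
      then have "X i \<in> ?C" "Y j \<notin> ?C" "Poly_Mapping.lookup c (X i) \<noteq> 0"
        using ij le_trans by (auto simp: I_def)
      then show ?thesis using cov[OF ij] by (simp add: ld)
    next
      \<comment> \<open>Here \<open>Y j\<close> alone carries at least \<open>k + 1\<close>, so
        after removal of one unit it still carries \<open>k\<close>, whatever happens at
        \<open>X i\<close>.\<close>
      case False
      then show ?thesis using cov[OF ij] X[of i] Y[of j] ij
        by (cases "i \<in> I") (auto simp: ld image_iff)
    qed
  qed
  have "c = ?u + d"
    unfolding d_def using le by (intro poly_mapping_eqI) (simp add: lookup_add lookup_minus)
  then show thesis using that[OF min fin card _ d] IN by blast
qed

text \<open>Only the generators have prescribed degrees. The monomial is a product of
  \<open>weight k c\<close> of them: peeling removes one minimal cover for each \<open>t\<close>,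
  and what remains is a product of variables.\<close>

lemma cover_term_in_grading:
  fixes Gr :: "nat \<Rightarrow> (vertex, 'k::field) S poly set"
  assumes Gr: "is_standard_grading (poset_graph n p r) Gr" and c: "cover k c"
  shows "monom (monomial c) k \<in> Gr (weight k c)"
  using c
proof (induction k arbitrary: c)
  case 0
  have "Poly_Mapping.keys c \<subseteq> verts \<Longrightarrow> monom (monomial c) 0 \<in> Gr m"
    if "m = (\<Sum>v\<in>verts. Poly_Mapping.lookup c v)" for m c
    using that
  proof (induction m arbitrary: c)
    case 0
    then have "c = 0" by (intro poly_mapping_eqI) (auto simp: in_keys_iff subset_iff)
    then have "monom (monomial c) 0 = (1 :: (vertex, 'k) S poly)"
      by (simp add: monomial_def monom_0 one_pCons)
    then show ?case using Gr by (simp add: is_standard_grading_def is_grading_def)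
  next
    case (Suc m)
    from Suc.prems obtain v where v: "v \<in> verts" "Poly_Mapping.lookup c v \<noteq> 0"
      by (metis nat.distinct(1) sum.neutral)
    define d where "d = c - Poly_Mapping.single v 1"
    have cd: "c = Poly_Mapping.single v 1 + d"
      using v by (intro poly_mapping_eqI) (auto simp: d_def lookup_add lookup_minus lookup_single when_def)
    have "Poly_Mapping.keys d \<subseteq> verts"
      using Suc.prems by (auto simp: d_def in_keys_iff lookup_minus subset_iff)
    moreover have "(\<Sum>w\<in>verts. Poly_Mapping.lookup c w) = 1 + (\<Sum>w\<in>verts. Poly_Mapping.lookup d w)"
      unfolding cd using v by (simp add: lookup_add sum.distrib lookup_single when_def)
    ultimately have "monom (monomial d) 0 \<in> Gr m" using Suc by simp
    moreover have "[:variable v:] \<in> Gr 1" using Gr v by (simp add: is_standard_grading_def fst_poset_graph)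
    ultimately have "[:variable v:] * monom (monomial d) 0 \<in> Gr (1 + m)"
      using Gr unfolding is_standard_grading_def is_grading_def by blast
    then show ?case by (simp add: cd monomial_add variable_def monom_0 mult.commute)
  qed
  with 0 show ?case by (simp add: cover_iff weight_def)
next
  case (Suc k)
  obtain C d where C: "is_minimal_vertex_cover (poset_graph n p r) C" "finite C" "card C = n"
      "C \<subseteq> verts" and d: "cover k d" and c: "c = (\<Sum>v\<in>C. Poly_Mapping.single v 1) + d"
    by (rule cover_peel[OF Suc.prems])
  have "monom (cover_monomial C) 1 \<in> Gr 1" using Gr C by (simp add: is_standard_grading_def)
  with Suc.IH[OF d] have "monom (cover_monomial C) 1 * monom (monomial d) k \<in> Gr (1 + weight k d)"
    using Gr unfolding is_standard_grading_def is_grading_def by blast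
  moreover have "weight (Suc k) c = 1 + weight k d"
  proof -
    have "(\<Sum>v\<in>verts. Poly_Mapping.lookup (\<Sum>v\<in>C. Poly_Mapping.single v 1) v) = n"
      unfolding lookup_indicator[OF C(2)] using C by (simp add: sum.If_cases Int_absorb1)
    then have "(\<Sum>v\<in>verts. Poly_Mapping.lookup c v) = n + (\<Sum>v\<in>verts. Poly_Mapping.lookup d v)"
      unfolding c lookup_add sum.distrib by simp
    then show ?thesis using cover_sum_ge[OF d] by (simp add: weight_def)
  qed
  ultimately show ?case by (simp add: c cover_monomial_eq monomial_add mult_monom)
qed

text \<open>Sorting the terms of \<open>f\<close> by weight gives components in the spans, hence in
  the pieces of the grading. For \<open>f\<close> in \<open>Gr i\<close>, the family concentrated at
  \<open>i\<close> is a second decomposition, and uniqueness identifies the two.\<close>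

lemma standard_grading_eq_span:
  fixes Gr :: "nat \<Rightarrow> (vertex, 'k::field) S poly set"
  assumes Gr: "is_standard_grading (poset_graph n p r) Gr"
  shows "Gr i = K_space.span (cover_term ` covers_of_weight i)"
proof
  let ?t = "cover_term :: _ \<Rightarrow> (vertex, 'k) S poly"
  have sub: "K_space.subspace (Gr j)" for j
    using Gr by (simp add: is_standard_grading_def is_grading_def)
  have span: "K_space.span (?t ` covers_of_weight j) \<subseteq> Gr j" for j
    using cover_term_in_grading[OF Gr] sub
    by (intro K_space.span_minimal) (auto simp: covers_of_weight_def)
  show "K_space.span (?t ` covers_of_weight i) \<subseteq> Gr i" by (rule span)
  show "Gr i \<subseteq> K_space.span (?t ` covers_of_weight i)"
  proof
    fix f assume f: "f \<in> Gr i"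
    let ?I = "{(k, c). cf f k c \<noteq> 0}" and ?w = "\<lambda>(k, c). weight k c"
    let ?m = "\<lambda>(k, c). scalar (cf f k c) * monom (monomial c) k"
    have fA: "f \<in> vertex_cover_algebra (poset_graph n p r)"
      using Gr f by (auto simp: is_standard_grading_def is_grading_def)
    have fin: "finite ?I" by (rule cf_finite)
    define u where "u j = (\<Sum>y\<in>{y\<in>?I. ?w y = j}. ?m y)" for j
    have u_span: "u j \<in> K_space.span (?t ` covers_of_weight j)" for j
      unfolding u_def
    proof (rule K_space.span_sum)
      fix y assume "y \<in> {y\<in>?I. ?w y = j}"
      then obtain k c where y: "y = (k, c)" "cf f k c \<noteq> 0" "weight k c = j" by auto
      then have "y \<in> covers_of_weight j"
        using fA by (simp add: vertex_cover_algebra_eq covers_of_weight_def)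
      then have "?t y \<in> K_space.span (?t ` covers_of_weight j)"
        by (intro K_space.span_base imageI)
      then show "?m y \<in> K_space.span (?t ` covers_of_weight j)"
        using K_space.span_scale by (simp add: y(1))
    qed
    have nz: "{j. u j \<noteq> 0} \<subseteq> ?w ` ?I"
    proof
      fix j assume j: "j \<in> {j. u j \<noteq> 0}"
      show "j \<in> ?w ` ?I"
      proof (rule ccontr)
        assume "j \<notin> ?w ` ?I"
        then have "{y\<in>?I. ?w y = j} = {}" by blast
        then have "u j = 0" unfolding u_def by (simp only: sum.empty)
        with j show False by simp
      qed
    qed
    have fu: "f = (\<Sum>j | u j \<noteq> 0. u j)"
    proof -
      have "f = sum ?m ?I" by (rule poly_expansion)
      also have "\<dots> = (\<Sum>j\<in>?w ` ?I. u j)" unfolding u_def by (rule sum.image_gen[OF fin])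
      also have "\<dots> = (\<Sum>j | u j \<noteq> 0. u j)"
        using fin nz by (intro sum.mono_neutral_right) auto
      finally show ?thesis .
    qed
    let ?P = "\<lambda>u. (\<forall>i. u i \<in> Gr i) \<and> finite {i. u i \<noteq> 0} \<and> f = (\<Sum>i | u i \<noteq> 0. u i)"
    have Pu: "?P u" using u_span span nz fin fu by (auto intro: finite_subset)
    have Pf: "?P (\<lambda>j. if j = i then f else 0)"
    proof -
      have "{j. (if j = i then f else 0) \<noteq> 0} = (if f = 0 then {} else {i})" by auto
      then show ?thesis using f sub by (auto simp: K_space.subspace_0)
    qed
    have "\<forall>f\<in>vertex_cover_algebra (poset_graph n p r). \<exists>!u. (\<forall>i. u i \<in> Gr i) \<and>
        finite {i. u i \<noteq> 0} \<and> f = (\<Sum>i | u i \<noteq> 0. u i)"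
      using Gr unfolding is_standard_grading_def is_grading_def by (elim conjE)
    note unique = the1_equality[OF bspec[OF this fA]]
    have "u = (\<lambda>j. if j = i then f else 0)"
      using unique[OF Pu] unique[OF Pf] by (rule trans[OF sym])
    then have "f = u i" by simp
    then show "f \<in> K_space.span (?t ` covers_of_weight i)" using u_span by simp
  qed
qed

section \<open>The Hilbert series and its numerator\<close>

lemma hilbert_series_eq:
  fixes Gr :: "nat \<Rightarrow> (vertex, 'k::field) S poly set"
  assumes "is_standard_grading (poset_graph n p r) Gr"
  shows "hilbert_series Gr = geo ^ n * bisum (enum below True N)"
proof (rule fps_ext)
  fix i
  show "hilbert_series Gr $ i = (geo ^ n * bisum (enum below True N)) $ i"
    unfolding hilbert_series_def standard_grading_eq_span[OF assms]
    using independent_cover_terms[OF finite_card_covers_of_weight(1)[of i], where 'k = 'k]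
      finite_card_covers_of_weight(2)[of i]
    by (simp add: K_space.dim_eq_card_independent)
qed

end

theorem corollary3p6:
  fixes n :: nat and P :: "'a set" and r :: "'a rel" and p :: "nat \<Rightarrow> 'a"
    and G :: "vertex graph"
    and Gr :: "nat \<Rightarrow> (vertex, 'k::field) S poly set"
  assumes "n \<ge> 1"
    and "partial_order_on P r"
    and "bij_betw p {1..n} P"
    and "\<And>i j. i \<in> {1..n} \<Longrightarrow> j \<in> {1..n} \<Longrightarrow> (p i, p j) \<in> r \<Longrightarrow> i \<le> j"
    and "G = poset_graph n p r"
    and "is_standard_grading G Gr"
  shows "\<exists>h :: int poly. is_h_polynomial (2 * n + 1) Gr h \<and> unimodal (coeffs h)"
proof -
  interpret natural_poset n p r
  proof
    show "(p i, p i) \<in> r" if "i \<in> {1..n}" for i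
      using assms(2,3) that unfolding partial_order_on_def preorder_on_def bij_betw_def
      by (auto simp: refl_on_def)
    show "trans r" using assms(2) unfolding partial_order_on_def preorder_on_def by blast
  qed (rule assms(4))
  have lt: "i < j" if "i \<in> N" "j \<in> N" "below i j" for i j
    using natural[of i j] that by simp
  obtain h where h: "gamma_positive n h" "bisum (enum below True N) = geo ^ Suc n * fps_of_poly h"
    using bisum_enum_gamma_positive[of N below True] lt by auto
  have "hilbert_series Gr = geo ^ n * bisum (enum below True N)"
    using assms(5,6) by (intro hilbert_series_eq) simp
  also have "\<dots> = geo ^ (2 * n + 1) * fps_of_poly h"
  proof -
    \<comment> \<open>The \<open>n\<close> factors from the vertices \<open>Y j\<close> and the
      \<open>Suc n\<close> from the enumeration together give the Krull dimension.\<close>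
    have "2 * n + 1 = n + Suc n" by simp
    then show ?thesis by (simp only: h(2) power_add mult.assoc)
  qed
  finally have "hilbert_series Gr * (1 - fps_X) ^ (2 * n + 1) =
      (geo * (1 - fps_X)) ^ (2 * n + 1) * fps_of_poly h"
    by (simp only: power_mult_distrib mult_ac)
  then have "is_h_polynomial (2 * n + 1) Gr h"
    by (simp only: is_h_polynomial_def geo_inverse power_one mult_1)
  then show ?thesis using gamma_positive_unimodal[OF h(1)] by blast
qed

end
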